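(* Let $\rho=\rho_{A_1A_2\cdots A_{\mathcal N}}$ be a state on $H_{A_1}\otimes\cdots\otimes H_{A_{\mathcal N}}$ with $\dim H_{A_i}=d_{A_i}$, and for each $i$ let $\{E^{A_i}_{\alpha,k}\}$ be an informationally complete $(N_{A_i},M_{A_i})$ POVM on $H_{A_i}$ with parameter $x_{A_i}$. Write $K_{A_i}=\frac{(d_{A_i}-1)(d_{A_i}^2+M_{A_i}^2x_{A_i})}{d_{A_i}M_{A_i}(M_{A_i}-1)}$. Let $\mu,\nu\in\mathbb{R}$ and $l$ a positive integer. If $\rho$ is fully separable, then for every $q\in\{1,\dots,\mathcal N\}$, $$\left\|\mathscr{M}^l_{\mu,\nu}(\rho_{A_q|\overline{A_q}})\right\|_{\mathrm{tr}}\le\sqrt{\left(l\mu^2+K_{A_q}\right)\left(l\nu^2+\prod_{i\ne q}K_{A_i}\right)}.$$ Hence a state violating this inequality for some $q$ is entangled (not fully separable).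
   Context: An $(N,M)$ POVM on $\mathbb{C}^d$ ($M\ge2$) consists of $N$ POVMs $\{E_{\alpha,k}\mid k=1,\dots,M\}$ satisfying $\mathrm{tr}(E_{\alpha,k})=d/M$, $\mathrm{tr}(E_{\alpha,k}^2)=x$, $\mathrm{tr}(E_{\alpha,k}E_{\alpha,l})=\frac{d-Mx}{M(M-1)}$ ($l\ne k$), $\mathrm{tr}(E_{\alpha,k}E_{\beta,l})=d/M^2$ ($\beta\ne\alpha$), where $\frac{d}{M^2}<x\le\min\{\frac{d^2}{M^2},\frac dM\}$; informationally complete means $N(M-1)=d^2-1$. Fully separable: a convex combination of tensor products $\rho^{A_1}_i\otimes\cdots\otimes\rho^{A_{\mathcal N}}_i$ of local density matrices. For fixed $q$, let $\overline{A_q}$ denote all parties other than $A_q$; $\rho_{A_q}$ and $\rho_{\overline{A_q}}$ are the reduced states. $\tau_{A_q}$ is the column vector with entries $\mathrm{tr}(E^{A_q}_{\alpha,k}\rho_{A_q})$; $\sigma_{\overline{A_q}}$ is the column vector with entries $\mathrm{tr}[(\bigotimes_{i\ne q}E^{A_i}_{\alpha_i,k_i})\rho_{\overline{A_q}}]$ indexed by the tuple $((\alpha_i,k_i))_{i\ne q}$; $\mathcal{P}(\rho_{A_q|\overline{A_q}})$ is the matrix with entries $\mathrm{tr}[(E^{A_1}_{\alpha_1,k_1}\otimes\cdots\otimes E^{A_{\mathcal N}}_{\alpha_{\mathcal N},k_{\mathcal N}})\rho]$ with row index $(\alpha_q,k_q)$ and column index $((\alpha_i,k_i))_{i\ne q}$,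 all in lexicographic order. Then $$\mathscr{M}^l_{\mu,\nu}(\rho_{A_q|\overline{A_q}})=\begin{pmatrix}\mu\nu J_{l\times l}&\mu\,\omega_l(\sigma_{\overline{A_q}})^T\\ \nu\,\omega_l(\tau_{A_q})&\mathcal{P}(\rho_{A_q|\overline{A_q}})\end{pmatrix},$$ where $J_{l\times l}$ is the $l\times l$ all-ones matrix and $\omega_l(V)=(V,\dots,V)$ has $l$ columns equal to $V$. $\|G\|_{\mathrm{tr}}=\mathrm{tr}\sqrt{G^\dagger G}$. *)

theory Defs
  imports "Jordan_Normal_Form.Matrix"
begin

definition mtrace :: "complex mat \<Rightarrow> complex" where
  "mtrace A = (\<Sum>i<dim_row A. A $$ (i,i))"

definition adj :: "complex mat \<Rightarrow> complex mat" where
  "adj A = mat (dim_col A) (dim_row A) (\<lambda>(i,j). cnj (A $$ (j,i)))"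

definition psd :: "complex mat \<Rightarrow> nat \<Rightarrow> bool" where
  "psd A n \<longleftrightarrow> A \<in> carrier_mat n n \<and> adj A = A \<and>
     (\<forall>v \<in> carrier_vec n. Im (conjugate v \<bullet> (A *\<^sub>v v)) = 0 \<and> 0 \<le> Re (conjugate v \<bullet> (A *\<^sub>v v)))"

definition density :: "complex mat \<Rightarrow> nat \<Rightarrow> bool" where
  "density R n \<longleftrightarrow> psd R n \<and> mtrace R = 1"

definition psd_sqrt :: "complex mat \<Rightarrow> complex mat" where
  "psd_sqrt A = (THE S. psd S (dim_row A) \<and> S * S = A)"

definition trace_norm :: "complex mat \<Rightarrow> real" where
  "trace_norm G = Re (mtrace (psd_sqrt (adj G * G)))"

text \<open>Digit i (0-based, digit 0 most significant) of c in the mixed radix system with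
  bases b 0, ..., b (n-1): this is the lexicographic ordering of index tuples.\<close>
definition mdigit :: "(nat \<Rightarrow> nat) \<Rightarrow> nat \<Rightarrow> nat \<Rightarrow> nat \<Rightarrow> nat" where
  "mdigit b n c i = (c div (\<Prod>j\<in>{Suc i..<n}. b j)) mod b i"

definition tensor_mat :: "nat \<Rightarrow> (nat \<Rightarrow> nat) \<Rightarrow> (nat \<Rightarrow> complex mat) \<Rightarrow> complex mat" where
  "tensor_mat n d F = mat (\<Prod>i<n. d i) (\<Prod>i<n. d i)
     (\<lambda>(r,c). \<Prod>i<n. F i $$ (mdigit d n r i, mdigit d n c i))"

definition fully_separable :: "nat \<Rightarrow> (nat \<Rightarrow> nat) \<Rightarrow> complex mat \<Rightarrow> bool" where
  "fully_separable n d \<rho> \<longleftrightarrow>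
     (\<exists>m (p :: nat \<Rightarrow> real) R. (\<forall>j<m. 0 \<le> p j) \<and> (\<Sum>j<m. p j) = 1 \<and>
        (\<forall>j<m. \<forall>i<n. density (R j i) (d i)) \<and>
        \<rho> = mat (\<Prod>i<n. d i) (\<Prod>i<n. d i)
               (\<lambda>(r,c). \<Sum>j<m. of_real (p j) * tensor_mat n d (R j) $$ (r,c)))"

definition NM_POVM :: "nat \<Rightarrow> nat \<Rightarrow> nat \<Rightarrow> real \<Rightarrow> (nat \<Rightarrow> nat \<Rightarrow> complex mat) \<Rightarrow> bool" where
  "NM_POVM d N M x E \<longleftrightarrow>
     M \<ge> 2 \<and> real d / real M ^ 2 < x \<and> x \<le> min (real d ^ 2 / real M ^ 2) (real d / real M) \<and>
     (\<forall>\<alpha><N. (\<forall>k<M. psd (E \<alpha> k) d) \<and>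
        (\<forall>i<d. \<forall>j<d. (\<Sum>k<M. E \<alpha> k $$ (i,j)) = (if i = j then 1 else 0))) \<and>
     (\<forall>\<alpha><N. \<forall>k<M. mtrace (E \<alpha> k) = of_real (real d / real M)) \<and>
     (\<forall>\<alpha><N. \<forall>k<M. mtrace (E \<alpha> k * E \<alpha> k) = of_real x) \<and>
     (\<forall>\<alpha><N. \<forall>k<M. \<forall>l<M. l \<noteq> k \<longrightarrow>
        mtrace (E \<alpha> k * E \<alpha> l) = of_real ((real d - real M * x) / (real M * (real M - 1)))) \<and>
     (\<forall>\<alpha><N. \<forall>\<beta><N. \<beta> \<noteq> \<alpha> \<longrightarrow> (\<forall>k<M. \<forall>l<M.
        mtrace (E \<alpha> k * E \<beta> l) = of_real (real d / real M ^ 2)))"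

definition IC_NM_POVM :: "nat \<Rightarrow> nat \<Rightarrow> nat \<Rightarrow> real \<Rightarrow> (nat \<Rightarrow> nat \<Rightarrow> complex mat) \<Rightarrow> bool" where
  "IC_NM_POVM d N M x E \<longleftrightarrow> NM_POVM d N M x E \<and> N * (M - 1) = d ^ 2 - 1"

definition Kconst :: "nat \<Rightarrow> nat \<Rightarrow> real \<Rightarrow> real" where
  "Kconst d M x = (real d - 1) * (real d ^ 2 + real M ^ 2 * x) / (real d * real M * (real M - 1))"

text \<open>Column radix: party i \<noteq> q contributes N i * M i values, party q is suppressed (radix 1).\<close>
definition col_radix :: "(nat \<Rightarrow> nat) \<Rightarrow> (nat \<Rightarrow> nat) \<Rightarrow> nat \<Rightarrow> nat \<Rightarrow> nat" where
  "col_radix N M q i = (if i = q then 1 else N i * M i)"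

text \<open>Local operator for party i, row r (encoding (\<alpha>_q,k_q) = (r div M q, r mod M q)) or identity,
  and column c (encoding the tuple ((\<alpha>_i,k_i))_{i\<noteq>q} lexicographically).\<close>
definition col_op :: "nat \<Rightarrow> (nat \<Rightarrow> nat) \<Rightarrow> (nat \<Rightarrow> nat) \<Rightarrow> (nat \<Rightarrow> nat) \<Rightarrow>
     (nat \<Rightarrow> nat \<Rightarrow> nat \<Rightarrow> complex mat) \<Rightarrow> nat \<Rightarrow> nat \<Rightarrow> nat \<Rightarrow> complex mat" where
  "col_op n d N M E q c i =
     (let t = mdigit (col_radix N M q) n c i in E i (t div M i) (t mod M i))"

text \<open>tau_{A_q}: entries tr(E^{A_q}_{\<alpha>,k} \<rho>_{A_q}) = tr((I \<otimes>..\<otimes> E \<otimes>..\<otimes> I) \<rho>).\<close>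
definition tau_vec :: "nat \<Rightarrow> (nat \<Rightarrow> nat) \<Rightarrow> (nat \<Rightarrow> nat) \<Rightarrow> (nat \<Rightarrow> nat) \<Rightarrow>
     (nat \<Rightarrow> nat \<Rightarrow> nat \<Rightarrow> complex mat) \<Rightarrow> complex mat \<Rightarrow> nat \<Rightarrow> nat \<Rightarrow> complex" where
  "tau_vec n d N M E \<rho> q r =
     mtrace (tensor_mat n d (\<lambda>i. if i = q then E q (r div M q) (r mod M q) else 1\<^sub>m (d i)) * \<rho>)"

text \<open>sigma_{rest}: entries tr((\<Otimes>_{i\<noteq>q} E_i) \<rho>_{rest}) = tr((E_1 \<otimes>..\<otimes> I_q \<otimes>..\<otimes> E_n) \<rho>).\<close>
definition sigma_vec :: "nat \<Rightarrow> (nat \<Rightarrow> nat) \<Rightarrow> (nat \<Rightarrow> nat) \<Rightarrow> (nat \<Rightarrow> nat) \<Rightarrow>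
     (nat \<Rightarrow> nat \<Rightarrow> nat \<Rightarrow> complex mat) \<Rightarrow> complex mat \<Rightarrow> nat \<Rightarrow> nat \<Rightarrow> complex" where
  "sigma_vec n d N M E \<rho> q c =
     mtrace (tensor_mat n d (\<lambda>i. if i = q then 1\<^sub>m (d q) else col_op n d N M E q c i) * \<rho>)"

definition P_entry :: "nat \<Rightarrow> (nat \<Rightarrow> nat) \<Rightarrow> (nat \<Rightarrow> nat) \<Rightarrow> (nat \<Rightarrow> nat) \<Rightarrow>
     (nat \<Rightarrow> nat \<Rightarrow> nat \<Rightarrow> complex mat) \<Rightarrow> complex mat \<Rightarrow> nat \<Rightarrow> nat \<Rightarrow> nat \<Rightarrow> complex" where
  "P_entry n d N M E \<rho> q r c =
     mtrace (tensor_mat n d (\<lambda>i. if i = q then E q (r div M q) (r mod M q)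
                                 else col_op n d N M E q c i) * \<rho>)"

definition Mlmat :: "nat \<Rightarrow> (nat \<Rightarrow> nat) \<Rightarrow> (nat \<Rightarrow> nat) \<Rightarrow> (nat \<Rightarrow> nat) \<Rightarrow>
     (nat \<Rightarrow> nat \<Rightarrow> nat \<Rightarrow> complex mat) \<Rightarrow> complex mat \<Rightarrow> nat \<Rightarrow> nat \<Rightarrow> real \<Rightarrow> real \<Rightarrow> complex mat" where
  "Mlmat n d N M E \<rho> q l \<mu> \<nu> =
     mat (l + N q * M q) (l + (\<Prod>i<n. col_radix N M q i))
       (\<lambda>(r,c). if r < l \<and> c < l then of_real (\<mu> * \<nu>)
                else if r < l then of_real \<mu> * sigma_vec n d N M E \<rho> q (c - l)
                else if c < l then of_real \<nu> * tau_vec n d N M E \<rho> q (r - l)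
                else P_entry n d N M E \<rho> q (r - l) (c - l))"

end

theory Submission
  imports Defs "Jordan_Normal_Form.Schur_Decomposition" "HOL-Analysis.L2_Norm"
begin

text \<open>
  For a product state the matrix has rank one: it is the outer product of the vectors
  (\<mu>, \<dots>, \<mu>, probabilities of party q) and (\<nu>, \<dots>, \<nu>, products of probabilities of the other
  parties). A fully separable state therefore gives a convex combination of such outer products,
  and the trace norm of an outer product is the product of the Euclidean norms.
  It remains to bound the sum of the squared probabilities of one party by its constant K.
  After subtracting the identity components, the POVM elements of one measurement form a simplex
  and those of different measurements are orthogonal, so Bessel's inequality together with
  tr (\<rho> \<rho>) \<le> 1 gives the bound, with N (M - 1) = d d - 1 used to evaluate the constant.
\<close>

section \<open>Hermitian matrices\<close>

text \<open>The obstacle is \<open>trace_norm\<close>: it refers to \<open>THE\<close> positive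
  square root of \<open>adj G * G\<close> and says nothing until such a root is known to exist and
  to be unique. Both facts come from a spectral theorem for Hermitian matrices, which also supplies
  the singular vectors of \<open>G\<close>. These bound a whole weighted sum of rank-one matrices at
  once, so no triangle inequality for the trace norm is established on the way. All four blocks
  average over the same weights: the corner block is constant and the weights sum to 1, and an
  identity factor contributes tr R = 1, which makes the reduced states appear without partial
  traces. The constant K has two sources. The uniform probabilities 1/M in N measurements contribute
  N/M. The deviations from 1/M contribute at most c (1 - 1/d), where 1 - 1/d bounds the squared norm
  of the traceless part of a density matrix and c = (x - d/M^2) M/(M - 1) is the only nonzero
  eigenvalue of the Gram matrix of the traceless POVM elements.\<close>

lemma mtrace_mult:
  assumes "A \<in> carrier_mat n m" "B \<in> carrier_mat m n"
  shows "mtrace (A * B) = (\<Sum>i<n. \<Sum>j<m. A $$ (i,j) * B $$ (j,i))"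
  using assms by (auto simp: mtrace_def scalar_prod_def lessThan_atLeast0 intro!: sum.cong)

lemma mtrace_mult_commute:
  assumes "A \<in> carrier_mat n m" "B \<in> carrier_mat m n"
  shows "mtrace (A * B) = mtrace (B * A)"
  unfolding mtrace_mult[OF assms] mtrace_mult[OF assms(2,1)]
  by (subst sum.swap) (simp add: mult.commute)

text \<open>If every root of the characteristic polynomial were \<open>c\<close>, the Schur
  triangular form would have a constant diagonal, and the trace, invariant under similarity, would
  be n c.\<close>

lemma exists_eigenvector_neq:
  fixes B :: "complex mat"
  assumes B: "B \<in> carrier_mat n n" and tr: "mtrace B \<noteq> of_nat n * c"
  shows "\<exists>e v. e \<noteq> c \<and> eigenvector B v e"
proof -
  obtain as where as: "char_poly B = (\<Prod>a\<leftarrow>as. [:- a, 1:])" and len: "length as = n"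
    using char_poly_factorized[OF B] by blast
  have "\<exists>a\<in>set as. a \<noteq> c"
  proof (rule ccontr)
    assume "\<not> ?thesis"
    then have all: "a = c" if "a \<in> set as" for a using that by blast
    obtain C P Q where s: "schur_decomposition B as = (C,P,Q)"
      by (cases "schur_decomposition B as") auto
    from schur_decomposition[OF B as s] have sim: "similar_mat_wit B C P Q" and dC: "diag_mat C = as"
      by auto
    note w = similar_mat_witD2[OF B sim]
    have "mtrace B = mtrace (P * (C * Q))" using w by (metis assoc_mult_mat)
    also have "\<dots> = mtrace ((C * Q) * P)" using w by (intro mtrace_mult_commute) auto
    also have "(C * Q) * P = C" using w by (metis assoc_mult_mat right_mult_one_mat)
    also have "mtrace C = (\<Sum>i<n. c)"
      unfolding mtrace_def
    proof (rule sum.cong)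
      show "{..<dim_row C} = {..<n}" using w by auto
      fix i assume i: "i \<in> {..<n}"
      then have "C $$ (i,i) = as ! i" unfolding dC[symmetric] diag_mat_def using w by auto
      then show "C $$ (i,i) = c" using all i len by auto
    qed
    finally show False using tr by simp
  qed
  then obtain a where a: "a \<in> set as" "a \<noteq> c" by blast
  then have "poly (char_poly B) a = 0" unfolding as by (rule_tac linear_poly_root)
  then have "eigenvalue B a" using eigenvalue_root_char_poly[OF B] by simp
  then show ?thesis using a unfolding eigenvalue_def by blast
qed

text \<open>Vectors are functions of which only the values below \<open>n\<close> count, so linear
  combinations are plain lambda terms and carry no dimension side conditions.\<close>

definition cinner :: "nat \<Rightarrow> (nat \<Rightarrow> complex) \<Rightarrow> (nat \<Rightarrow> complex) \<Rightarrow> complex" where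
  "cinner n f g = (\<Sum>a<n. cnj (f a) * g a)"

definition mat_app :: "nat \<Rightarrow> complex mat \<Rightarrow> (nat \<Rightarrow> complex) \<Rightarrow> nat \<Rightarrow> complex" where
  "mat_app n A f a = (\<Sum>b<n. A $$ (a,b) * f b)"

section \<open>Inner product algebra and Bessel's inequality\<close>

lemma cinner_cong: "(\<And>a. a < n \<Longrightarrow> f a = f' a) \<Longrightarrow> (\<And>a. a < n \<Longrightarrow> g a = g' a) \<Longrightarrow> cinner n f g = cinner n f' g'"
  by (simp add: cinner_def)

lemma cnj_cinner: "cnj (cinner n f g) = cinner n g f"
  by (simp add: cinner_def mult.commute)

lemma cinner_self: "cinner n f f = of_real (\<Sum>a<n. (cmod (f a))\<^sup>2)"
  by (simp only: cinner_def of_real_sum complex_norm_square mult.commute)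

lemma cinner_self_eq_0D: "cinner n f f = 0 \<Longrightarrow> a < n \<Longrightarrow> f a = 0"
  unfolding cinner_self of_real_eq_0_iff by (subst (asm) sum_nonneg_eq_0_iff) auto

lemma cinner_sum_right: "cinner n f (\<lambda>a. \<Sum>i\<in>I. c i * g i a) = (\<Sum>i\<in>I. c i * cinner n f (g i))"
  by (simp add: cinner_def sum_distrib_left mult_ac) (rule sum.swap)

lemma cinner_sum_left: "cinner n (\<lambda>a. \<Sum>i\<in>I. c i * g i a) f = (\<Sum>i\<in>I. cnj (c i) * cinner n (g i) f)"
  by (simp add: cinner_def sum_distrib_left sum_distrib_right mult_ac) (rule sum.swap)

lemma cinner_scale_right: "cinner n f (\<lambda>a. c * g a) = c * cinner n f g"
  by (simp add: cinner_def sum_distrib_left mult_ac)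

lemma cinner_scale_left: "cinner n (\<lambda>a. c * g a) f = cnj c * cinner n g f"
  by (simp add: cinner_def sum_distrib_left mult_ac)

lemma cinner_diff_right: "cinner n f (\<lambda>a. g a - h a) = cinner n f g - cinner n f h"
  by (simp add: cinner_def algebra_simps sum_subtractf)

lemma cinner_diff_left: "cinner n (\<lambda>a. g a - h a) f = cinner n g f - cinner n h f"
  by (simp add: cinner_def algebra_simps sum_subtractf)

lemma mat_app_cong: "(\<And>b. b < n \<Longrightarrow> f b = g b) \<Longrightarrow> mat_app n A f = mat_app n A g"
  by (auto simp: mat_app_def fun_eq_iff)

lemma mat_app_scale: "mat_app n A (\<lambda>a. c * f a) = (\<lambda>a. c * mat_app n A f a)"
  by (simp add: mat_app_def sum_distrib_left mult_ac fun_eq_iff)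

lemma mat_app_diff: "mat_app n A (\<lambda>a. f a - g a) = (\<lambda>a. mat_app n A f a - mat_app n A g a)"
  by (simp add: mat_app_def algebra_simps sum_subtractf fun_eq_iff)

text \<open>Stating the adjoint relation entrywise lets one lemma serve both a Hermitian matrix,
  where \<open>B\<close> is \<open>A\<close> itself, and a rectangular \<open>G\<close> paired with
  \<open>adj G\<close>.\<close>

lemma cinner_mat_app_adjoint:
  assumes "\<And>a b. a < m \<Longrightarrow> b < n \<Longrightarrow> B $$ (b,a) = cnj (A $$ (a,b))"
  shows "cinner m f (mat_app n A g) = cinner n (mat_app m B f) g"
  unfolding cinner_def mat_app_def
  by (simp add: sum_distrib_left sum_distrib_right assms mult_ac) (rule sum.swap)

text \<open>The projection \<open>g\<close> of \<open>f\<close> onto the family satisfies <g,f> =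
  <g,g>, so the squared length of \<open>f - g\<close> is exactly the difference of the two
  sides.\<close>

lemma bessel:
  assumes I: "finite I" and on: "\<And>i j. i \<in> I \<Longrightarrow> j \<in> I \<Longrightarrow> cinner n (y i) (y j) = (if i = j then 1 else 0)"
  shows "(\<Sum>i\<in>I. (cmod (cinner n (y i) f))\<^sup>2) \<le> (\<Sum>a<n. (cmod (f a))\<^sup>2)"
proof -
  define c where "c i = cinner n (y i) f" for i
  define g where "g a = (\<Sum>i\<in>I. c i * y i a)" for a
  have gh: "cinner n g h = (\<Sum>i\<in>I. cnj (c i) * cinner n (y i) h)" for h
    unfolding g_def by (rule cinner_sum_left)
  have fg: "cinner n g f = (\<Sum>i\<in>I. cnj (c i) * c i)"
    unfolding gh by (simp add: c_def)
  have yg: "cinner n (y i) g = c i" if "i \<in> I" for i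
    unfolding g_def cinner_sum_right using I that by (simp add: on if_distrib cong: if_cong sum.cong)
  have gg: "cinner n g g = (\<Sum>i\<in>I. cnj (c i) * c i)"
    unfolding gh by (simp add: yg)
  have "cinner n (\<lambda>a. f a - g a) (\<lambda>a. f a - g a) = cinner n f f - cinner n g f - cnj (cinner n g f) + cinner n g g"
    by (simp add: cinner_diff_left cinner_diff_right cnj_cinner)
  also have "\<dots> = cinner n f f - (\<Sum>i\<in>I. cnj (c i) * c i)"
    unfolding fg gg by (simp add: mult.commute)
  also have "(\<Sum>i\<in>I. cnj (c i) * c i) = of_real (\<Sum>i\<in>I. (cmod (c i))\<^sup>2)"
    by (simp only: of_real_sum complex_norm_square mult.commute)
  finally have "complex_of_real (\<Sum>a<n. (cmod (f a - g a))\<^sup>2)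
      = of_real ((\<Sum>a<n. (cmod (f a))\<^sup>2) - (\<Sum>i\<in>I. (cmod (c i))\<^sup>2))"
    unfolding cinner_self by simp
  then have "(\<Sum>a<n. (cmod (f a - g a))\<^sup>2) = (\<Sum>a<n. (cmod (f a))\<^sup>2) - (\<Sum>i\<in>I. (cmod (c i))\<^sup>2)"
    unfolding of_real_eq_iff .
  moreover have "0 \<le> (\<Sum>a<n. (cmod (f a - g a))\<^sup>2)" by (simp add: sum_nonneg)
  ultimately show ?thesis unfolding c_def by simp
qed

text \<open>Deflation: replacing the known eigenvalues of A by a real c yields a Hermitian B. Since c is
  chosen such that tr B \<noteq> n c, B has an eigenvalue different from c, and its eigenvectors are
  orthogonal to the known ones.\<close>
lemma hermitian_new_eigenvector:
  assumes herm: "\<And>a b. a < n \<Longrightarrow> b < n \<Longrightarrow> A $$ (a,b) = cnj (A $$ (b,a))"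
    and on: "\<And>i j. i < k \<Longrightarrow> j < k \<Longrightarrow> cinner n (w i) (w j) = (if i = j then 1 else 0)"
    and ev: "\<And>i a. i < k \<Longrightarrow> a < n \<Longrightarrow> mat_app n A (w i) a = of_real (s i) * w i a"
    and k: "k < n"
  shows "\<exists>v (r::real). cinner n v v = 1 \<and> (\<forall>i<k. cinner n (w i) v = 0) \<and> (\<forall>a<n. mat_app n A v a = of_real r * v a)"
proof -
  \<comment> \<open>The sum of the eigenvalues of \<open>A\<close> still to be found.
    \<open>A\<close> is known only through its entries below \<open>n\<close>, hence the
    truncation.\<close>
  define t where "t = Re (mtrace (mat n n (\<lambda>(a,b). A $$ (a,b)))) - (\<Sum>i<k. s i)"
  \<comment> \<open>The real part of tr B will be t + k c, which equals n c exactly for c = t / (n -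
    k). Adding 1 avoids this value.\<close>
  define c where "c = t / (real n - real k) + 1"
  define B where "B = mat n n (\<lambda>(a,b). A $$ (a,b) + (\<Sum>i<k. of_real (c - s i) * w i a * cnj (w i b)))"
  have B: "B \<in> carrier_mat n n" by (simp add: B_def)
  have appB: "mat_app n B f a = mat_app n A f a + (\<Sum>i<k. of_real (c - s i) * cinner n (w i) f * w i a)"
    if "a < n" for f a
  proof -
    have "(\<Sum>b<n. (\<Sum>i<k. of_real (c - s i) * w i a * cnj (w i b)) * f b)
       = (\<Sum>i<k. \<Sum>b<n. of_real (c - s i) * w i a * cnj (w i b) * f b)"
      unfolding sum_distrib_right by (rule sum.swap)
    also have "\<dots> = (\<Sum>i<k. of_real (c - s i) * cinner n (w i) f * w i a)"
      by (simp add: cinner_def sum_distrib_left sum_distrib_right mult_ac)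
    finally show ?thesis
      using that by (simp add: mat_app_def B_def distrib_right sum.distrib)
  qed
  have "mtrace B = mtrace (mat n n (\<lambda>(a,b). A $$ (a,b))) + (\<Sum>i<k. of_real (c - s i) * cinner n (w i) (w i))"
    unfolding mtrace_def B_def cinner_def
    by (simp add: sum.distrib sum_distrib_left mult_ac) (rule sum.swap)
  also have "(\<Sum>i<k. of_real (c - s i) * cinner n (w i) (w i)) = of_real (real k * c - (\<Sum>i<k. s i))"
    by (simp add: on sum_subtractf)
  finally have "Re (mtrace B) = t + real k * c" by (simp add: t_def)
  moreover have "t + real k * c \<noteq> real n * c"
  proof
    assume "t + real k * c = real n * c"
    then have "t = (real n - real k) * c" by (simp add: algebra_simps)
    also have "\<dots> = t + (real n - real k)" using k unfolding c_def by (simp add: field_simps)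
    finally show False using k by simp
  qed
  ultimately have "mtrace B \<noteq> of_nat n * of_real c" by (metis Re_complex_of_real of_real_mult of_real_of_nat_eq)
  from exists_eigenvector_neq[OF B this] obtain e v0 where e: "e \<noteq> of_real c" and "eigenvector B v0 e"
    by blast
  then have v0: "v0 \<in> carrier_vec n" "v0 \<noteq> 0\<^sub>v n" "B *\<^sub>v v0 = e \<cdot>\<^sub>v v0"
    using B by (auto simp: eigenvector_def)
  define v where "v a = v0 $ a" for a
  have Bv: "mat_app n B v a = e * v a" if a: "a < n" for a
  proof -
    have "mat_app n B v a = (B *\<^sub>v v0) $ a"
      using a B v0(1) by (auto simp: mat_app_def v_def scalar_prod_def lessThan_atLeast0 intro!: sum.cong)
    then show ?thesis using a v0 by (simp add: v_def)
  qed
  \<comment> \<open>Pairing B v with \<open>w i\<close> in two ways gives e <w i, v> = c <w i, v>: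
    the deflation has replaced the eigenvalue \<open>s i\<close> by \<open>c\<close>, and
    \<open>e\<close> differs from \<open>c\<close>.\<close>
  have orth: "cinner n (w i) v = 0" if i: "i < k" for i
  proof -
    have "e * cinner n (w i) v = cinner n (w i) (mat_app n B v)"
      by (subst cinner_scale_right[symmetric]) (rule cinner_cong, simp_all add: Bv)
    also have "\<dots> = cinner n (w i) (mat_app n A v) + (\<Sum>j<k. of_real (c - s j) * cinner n (w j) v * cinner n (w i) (w j))"
      unfolding cinner_sum_right[symmetric]
      by (simp add: cinner_def appB distrib_left sum.distrib)
    also have "(\<Sum>j<k. of_real (c - s j) * cinner n (w j) v * cinner n (w i) (w j)) = of_real (c - s i) * cinner n (w i) v"
      using i by (simp add: on if_distrib cong: if_cong)
    also have "cinner n (w i) (mat_app n A v) = cinner n (mat_app n A (w i)) v"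
      by (rule cinner_mat_app_adjoint) (rule herm)
    also have "\<dots> = cinner n (\<lambda>a. of_real (s i) * w i a) v"
      by (rule cinner_cong) (simp_all add: ev i)
    finally have "e * cinner n (w i) v = of_real c * cinner n (w i) v"
      by (simp add: cinner_scale_left algebra_simps)
    then show ?thesis using e by simp
  qed
  \<comment> \<open>On vectors orthogonal to all \<open>w i\<close> the correction in
    \<open>B\<close> vanishes, so \<open>B\<close> and \<open>A\<close> agree there.\<close>
  have Av: "mat_app n A v a = e * v a" if "a < n" for a
    using appB[OF that, of v] Bv[OF that] by (simp add: orth)
  define q where "q = (\<Sum>a<n. (cmod (v a))\<^sup>2)"
  have vv: "cinner n v v = of_real q" unfolding q_def by (rule cinner_self)
  have "q \<noteq> 0"
  proof
    assume "q = 0"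
    then have "v a = 0" if "a < n" for a using cinner_self_eq_0D[OF _ that] vv by simp
    then have "v0 = 0\<^sub>v n" using v0(1) by (intro eq_vecI) (auto simp: v_def)
    then show False using v0 by simp
  qed
  then have q: "q > 0" by (metis q_def less_eq_real_def sum_nonneg zero_le_power2)
  \<comment> \<open>Moving the Hermitian \<open>A\<close> across the inner product conjugates the
    eigenvalue, so \<open>e\<close> is real.\<close>
  have "e * of_real q = cinner n v (mat_app n A v)"
    unfolding vv[symmetric] by (subst cinner_scale_right[symmetric]) (rule cinner_cong, simp_all add: Av)
  also have "\<dots> = cinner n (mat_app n A v) v" by (rule cinner_mat_app_adjoint) (rule herm)
  also have "\<dots> = cnj e * of_real q"
    unfolding vv[symmetric] by (subst cinner_scale_left[symmetric]) (rule cinner_cong, simp_all add: Av)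
  finally have "e = cnj e" using q by simp
  then have e_real: "e = of_real (Re e)" by (metis Reals_cnj_iff of_real_Re)
  show ?thesis
  proof (intro exI conjI allI impI)
    let ?v = "\<lambda>a. of_real (1 / sqrt q) * v a"
    have "complex_of_real (1 / sqrt q) * (of_real (1 / sqrt q) * of_real q) = of_real (1 / sqrt q * (1 / sqrt q * q))"
      by (simp only: of_real_mult)
    also have "1 / sqrt q * (1 / sqrt q * q) = 1" using q by (simp add: field_simps)
    finally show "cinner n ?v ?v = 1" unfolding cinner_scale_left cinner_scale_right vv by simp
    show "cinner n (w i) ?v = 0" if "i < k" for i by (subst cinner_scale_right) (simp add: orth that)
    show "mat_app n A ?v a = of_real (Re e) * ?v a" if "a < n" for a
      by (subst mat_app_scale) (simp add: Av that e_real[symmetric])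
  qed
qed

lemma hermitian_orthonormal_eigenvectors:
  assumes herm: "\<And>a b. a < n \<Longrightarrow> b < n \<Longrightarrow> A $$ (a,b) = cnj (A $$ (b,a))" and "k \<le> n"
  shows "\<exists>w (s::nat \<Rightarrow> real). (\<forall>i<k. \<forall>j<k. cinner n (w i) (w j) = (if i = j then 1 else 0)) \<and>
     (\<forall>i<k. \<forall>a<n. mat_app n A (w i) a = of_real (s i) * w i a)"
  using \<open>k \<le> n\<close>
proof (induction k)
  case (Suc k)
  from Suc.IH[OF Suc_leD[OF Suc.prems]] obtain w s where
    ws: "(\<forall>i<k. \<forall>j<k. cinner n (w i) (w j) = (if i = j then 1 else 0)) \<and>
      (\<forall>i<k. \<forall>a<n. mat_app n A (w i) a = of_real (s i) * w i a)"
    by (elim exE) (rule that)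
  note on = ws[THEN conjunct1, rule_format] and ev = ws[THEN conjunct2, rule_format]
  have "k < n" using Suc.prems by simp
  have "\<exists>v (r::real). cinner n v v = 1 \<and> (\<forall>i<k. cinner n (w i) v = 0) \<and> (\<forall>a<n. mat_app n A v a = of_real r * v a)"
    by (rule hermitian_new_eigenvector[where s = s, OF _ _ _ \<open>k < n\<close>]; rule herm on ev; assumption)
  then obtain v r where
    vr: "cinner n v v = 1 \<and> (\<forall>i<k. cinner n (w i) v = 0) \<and> (\<forall>a<n. mat_app n A v a = of_real r * v a)"
    by (elim exE) (rule that)
  note v = vr[THEN conjunct1] vr[THEN conjunct2, THEN conjunct1, rule_format]
    vr[THEN conjunct2, THEN conjunct2, rule_format]
  have v': "cinner n v (w i) = 0" if "i < k" for i
    using v(2)[OF that] cnj_cinner[of n "w i" v] by simp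
  show ?case
    by (intro exI[of _ "w(k := v)"] exI[of _ "s(k := r)"]) (auto simp: less_Suc_eq on ev v v')
qed auto

text \<open>The \<open>n\<close> eigenvectors form a square matrix whose one-sided inverse is
  two-sided. Orthonormality therefore yields the completeness relation, and inserting that relation
  into \<open>A\<close> yields the decomposition.\<close>

lemma spectral_theorem:
  assumes herm: "\<And>a b. a < n \<Longrightarrow> b < n \<Longrightarrow> A $$ (a,b) = cnj (A $$ (b,a))"
  obtains w and s :: "nat \<Rightarrow> real" where
    "\<And>i j. i < n \<Longrightarrow> j < n \<Longrightarrow> cinner n (w i) (w j) = (if i = j then 1 else 0)"
    "\<And>a b. a < n \<Longrightarrow> b < n \<Longrightarrow> (\<Sum>i<n. w i a * cnj (w i b)) = (if a = b then 1 else 0)"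
    "\<And>i a. i < n \<Longrightarrow> a < n \<Longrightarrow> mat_app n A (w i) a = of_real (s i) * w i a"
    "\<And>a b. a < n \<Longrightarrow> b < n \<Longrightarrow> A $$ (a,b) = (\<Sum>i<n. of_real (s i) * w i a * cnj (w i b))"
proof -
  have "\<exists>w (s::nat \<Rightarrow> real). (\<forall>i<n. \<forall>j<n. cinner n (w i) (w j) = (if i = j then 1 else 0)) \<and>
     (\<forall>i<n. \<forall>a<n. mat_app n A (w i) a = of_real (s i) * w i a)"
    by (rule hermitian_orthonormal_eigenvectors[OF _ order_refl]) (rule herm)
  then obtain w s where
    ws: "(\<forall>i<n. \<forall>j<n. cinner n (w i) (w j) = (if i = j then 1 else 0)) \<and>
      (\<forall>i<n. \<forall>a<n. mat_app n A (w i) a = of_real (s i) * w i a)"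
    by (elim exE) (rule that)
  note on = ws[THEN conjunct1, rule_format] and ev = ws[THEN conjunct2, rule_format]
  define W where "W = mat n n (\<lambda>(a,i). w i a)"
  define V where "V = mat n n (\<lambda>(i,a). cnj (w i a))"
  have WV: "W \<in> carrier_mat n n" "V \<in> carrier_mat n n" by (auto simp: W_def V_def)
  have "V * W = 1\<^sub>m n"
    using on by (intro eq_matI) (auto simp: W_def V_def scalar_prod_def cinner_def lessThan_atLeast0)
  from mat_mult_left_right_inverse[OF WV(2,1) this] have WV1: "W * V = 1\<^sub>m n" .
  have comp: "(\<Sum>i<n. w i a * cnj (w i b)) = (if a = b then 1 else 0)" if "a < n" "b < n" for a b
  proof -
    have "(W * V) $$ (a,b) = (\<Sum>i<n. w i a * cnj (w i b))"
      using that by (auto simp: W_def V_def scalar_prod_def lessThan_atLeast0)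
    then show ?thesis using that WV1 by simp
  qed
  have "A $$ (a,b) = (\<Sum>i<n. of_real (s i) * w i a * cnj (w i b))" if a: "a < n" and b: "b < n" for a b
  proof -
    have "(\<Sum>i<n. of_real (s i) * w i a * cnj (w i b)) = (\<Sum>i<n. mat_app n A (w i) a * cnj (w i b))"
      by (simp add: ev a)
    also have "\<dots> = (\<Sum>c<n. A $$ (a,c) * (\<Sum>i<n. w i c * cnj (w i b)))"
      unfolding mat_app_def sum_distrib_left sum_distrib_right by (subst sum.swap) (simp add: mult_ac)
    also have "\<dots> = A $$ (a,b)"
      using b by (simp add: comp if_distrib cong: if_cong)
    finally show ?thesis by simp
  qed
  with on comp ev show ?thesis by (rule that)
qed

section \<open>Positive square roots and the trace norm\<close>

lemma adj_carrier: "G \<in> carrier_mat m k \<Longrightarrow> adj G \<in> carrier_mat k m"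
  by (auto simp: adj_def)

lemma adj_index: "G \<in> carrier_mat m k \<Longrightarrow> a < k \<Longrightarrow> r < m \<Longrightarrow> adj G $$ (a,r) = cnj (G $$ (r,a))"
  by (auto simp: adj_def)

lemma mat_app_mult:
  assumes "A \<in> carrier_mat n m" "B \<in> carrier_mat m k" "a < n"
  shows "mat_app m A (mat_app k B f) a = mat_app k (A * B) f a"
proof -
  have "mat_app k (A * B) f a = (\<Sum>b<k. (\<Sum>c<m. A $$ (a,c) * B $$ (c,b)) * f b)"
    using assms by (auto simp: mat_app_def scalar_prod_def lessThan_atLeast0 intro!: sum.cong)
  also have "\<dots> = (\<Sum>c<m. \<Sum>b<k. A $$ (a,c) * B $$ (c,b) * f b)"
    unfolding sum_distrib_right by (rule sum.swap)
  finally show ?thesis by (simp add: mat_app_def sum_distrib_left mult_ac)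
qed

lemma quadratic_form_eq_cinner:
  assumes "A \<in> carrier_mat n n" "v \<in> carrier_vec n"
  shows "conjugate v \<bullet> (A *\<^sub>v v) = cinner n (\<lambda>a. v $ a) (mat_app n A (\<lambda>a. v $ a))"
  using assms by (auto simp: cinner_def mat_app_def scalar_prod_def lessThan_atLeast0 intro!: sum.cong)

section \<open>Positive semidefinite matrices and their square roots\<close>

lemma psd_hermitian: "psd A n \<Longrightarrow> a < n \<Longrightarrow> b < n \<Longrightarrow> A $$ (a,b) = cnj (A $$ (b,a))"
  using adj_index[of A n n a b] by (auto simp: psd_def)

lemma psd_carrier: "psd A n \<Longrightarrow> A \<in> carrier_mat n n"
  by (simp add: psd_def)

lemma psd_nonneg:
  assumes "psd A n"
  shows "0 \<le> Re (cinner n f (mat_app n A f))"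
proof -
  have "0 \<le> Re (conjugate (vec n f) \<bullet> (A *\<^sub>v vec n f))"
    using assms unfolding psd_def by simp
  also have "\<dots> = Re (cinner n (\<lambda>a. vec n f $ a) (mat_app n A (\<lambda>a. vec n f $ a)))"
    using psd_carrier[OF assms] by (subst quadratic_form_eq_cinner) auto
  also have "mat_app n A (\<lambda>a. vec n f $ a) = mat_app n A f" by (rule mat_app_cong) simp
  also have "cinner n (\<lambda>a. vec n f $ a) (mat_app n A f) = cinner n f (mat_app n A f)" by (rule cinner_cong) auto
  finally show ?thesis .
qed

text \<open>Hermiticity alone makes the quadratic form real, so only the sign of its real part
  remains to be shown.\<close>

lemma psdI:
  assumes A: "A \<in> carrier_mat n n"
    and herm: "\<And>a b. a < n \<Longrightarrow> b < n \<Longrightarrow> A $$ (a,b) = cnj (A $$ (b,a))"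
    and nonneg: "\<And>f. 0 \<le> Re (cinner n f (mat_app n A f))"
  shows "psd A n"
  unfolding psd_def
proof (intro conjI ballI)
  show "adj A = A"
  proof (rule eq_matI)
    show "adj A $$ (i,j) = A $$ (i,j)" if "i < dim_row A" "j < dim_col A" for i j
      using adj_index[OF A, of i j] herm[of i j] that A by simp
  qed (use adj_carrier[OF A] A in auto)
  fix v :: "complex vec" assume v: "v \<in> carrier_vec n"
  let ?f = "\<lambda>a. v $ a"
  have "cnj (cinner n ?f (mat_app n A ?f)) = cinner n ?f (mat_app n A ?f)"
    unfolding cnj_cinner by (rule cinner_mat_app_adjoint[symmetric]) (rule herm)
  then show "Im (conjugate v \<bullet> (A *\<^sub>v v)) = 0"
    unfolding quadratic_form_eq_cinner[OF A v] by (metis Reals_cnj_iff complex_is_Real_iff)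
  show "0 \<le> Re (conjugate v \<bullet> (A *\<^sub>v v))"
    unfolding quadratic_form_eq_cinner[OF A v] by (rule nonneg)
qed fact

lemma psd_eigenvalue_nonneg:
  assumes "psd A n" and "cinner n f f = 1" and ev: "\<And>a. a < n \<Longrightarrow> mat_app n A f a = of_real s * f a"
  shows "0 \<le> s"
proof -
  have "cinner n f (mat_app n A f) = cinner n f (\<lambda>a. of_real s * f a)" by (rule cinner_cong) (simp_all add: ev)
  then show ?thesis using psd_nonneg[OF assms(1), of f] assms(2) by (simp add: cinner_scale_right)
qed

text \<open>Completeness recovers every entry of a matrix from its action on the family
  \<open>w\<close>.\<close>

lemma mat_eq_on_basis:
  assumes X: "X \<in> carrier_mat m n" and Y: "Y \<in> carrier_mat m n"
    and comp: "\<And>a b. a < n \<Longrightarrow> b < n \<Longrightarrow> (\<Sum>i<n. w i a * cnj (w i b)) = (if a = b then 1 else 0)"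
    and eq: "\<And>i a. i < n \<Longrightarrow> a < m \<Longrightarrow> mat_app n X (w i) a = mat_app n Y (w i) a"
  shows "X = Y"
proof (rule eq_matI)
  have expand: "Z $$ (a,b) = (\<Sum>i<n. mat_app n Z (w i) a * cnj (w i b))" if "b < n" for Z a b
  proof -
    have "(\<Sum>i<n. mat_app n Z (w i) a * cnj (w i b)) = (\<Sum>c<n. Z $$ (a,c) * (\<Sum>i<n. w i c * cnj (w i b)))"
      unfolding mat_app_def sum_distrib_left sum_distrib_right by (subst sum.swap) (simp add: mult_ac)
    also have "\<dots> = Z $$ (a,b)" using that by (simp add: comp if_distrib cong: if_cong)
    finally show ?thesis by simp
  qed
  show "X $$ (a,b) = Y $$ (a,b)" if "a < dim_row Y" "b < dim_col Y" for a b
    using that Y expand[of b X a] expand[of b Y a] by (simp add: eq)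
qed (use X Y in auto)

text \<open>Let S w = s w. Then T T w = s^2 w, so z = T w - s w satisfies T z = - s z. For s > 0
  this contradicts positivity of \<open>T\<close> unless z = 0; for s = 0 the squared length of T w
  is <w, T T w> = 0. Hence \<open>T\<close> agrees with \<open>S\<close> on an eigenbasis of
  \<open>S\<close>.\<close>

lemma psd_sqrt_unique:
  assumes S: "psd S n" and T: "psd T n" and eq: "S * S = T * T"
  shows "S = T"
proof -
  note Sc = psd_carrier[OF S] and Tc = psd_carrier[OF T]
  obtain w s where on: "\<And>i j. i < n \<Longrightarrow> j < n \<Longrightarrow> cinner n (w i) (w j) = (if i = j then 1 else 0)"
    and comp: "\<And>a b. a < n \<Longrightarrow> b < n \<Longrightarrow> (\<Sum>i<n. w i a * cnj (w i b)) = (if a = b then 1 else 0)"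
    and ev: "\<And>i a. i < n \<Longrightarrow> a < n \<Longrightarrow> mat_app n S (w i) a = of_real (s i) * w i a"
    by (rule spectral_theorem[of n S, OF psd_hermitian[OF S]]) auto
  show ?thesis
  proof (rule mat_eq_on_basis[OF Sc Tc comp])
    fix i a assume i: "i < n" and a: "a < n"
    have s0: "0 \<le> s i" using psd_eigenvalue_nonneg[OF S, of "w i" "s i"] on[OF i i] ev[OF i] by simp
    have TT: "mat_app n T (mat_app n T (w i)) b = of_real (s i * s i) * w i b" if b: "b < n" for b
    proof -
      have "mat_app n T (mat_app n T (w i)) b = mat_app n S (mat_app n S (w i)) b"
        by (simp add: mat_app_mult[OF Tc Tc b] mat_app_mult[OF Sc Sc b] eq)
      also have "mat_app n S (mat_app n S (w i)) = mat_app n S (\<lambda>a. of_real (s i) * w i a)"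
        by (rule mat_app_cong) (simp add: ev i)
      finally show ?thesis by (simp add: mat_app_scale ev i b)
    qed
    define z where "z b = mat_app n T (w i) b - of_real (s i) * w i b" for b
    have Tz: "mat_app n T z b = - of_real (s i) * z b" if "b < n" for b
      unfolding z_def mat_app_diff mat_app_scale by (simp add: TT that algebra_simps)
    have "cinner n z (mat_app n T z) = cinner n z (\<lambda>b. - of_real (s i) * z b)" by (rule cinner_cong) (simp_all add: Tz)
    then have zTz: "cinner n z (mat_app n T z) = - of_real (s i) * cinner n z z" by (simp only: cinner_scale_right)
    have "cinner n z z = 0"
    proof (cases "s i = 0")
      case True
      then have z: "z = mat_app n T (w i)" by (auto simp: z_def)
      have "cinner n (mat_app n T (w i)) (mat_app n T (w i)) = cinner n (w i) (mat_app n T (mat_app n T (w i)))"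
        by (rule cinner_mat_app_adjoint[symmetric]) (rule psd_hermitian[OF T])
      also have "\<dots> = cinner n (w i) (\<lambda>b. 0 * w i b)" by (rule cinner_cong) (simp_all add: TT True)
      finally show ?thesis unfolding z cinner_scale_right by simp
    next
      case False
      then have s: "s i > 0" using s0 by simp
      have "0 \<le> - (s i * Re (cinner n z z))" using psd_nonneg[OF T, of z] unfolding zTz by simp
      then have "Re (cinner n z z) \<le> 0" using s by (simp add: mult_le_0_iff)
      moreover have "Re (cinner n z z) \<ge> 0" unfolding cinner_self by (simp add: sum_nonneg)
      ultimately show ?thesis unfolding cinner_self by simp
    qed
    from cinner_self_eq_0D[OF this a] show "mat_app n S (w i) a = mat_app n T (w i) a"
      by (simp add: z_def ev i a)
  qed
qed

text \<open>The root keeps the eigenvectors of \<open>A\<close> and takes the square roots of its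
  eigenvalues, which positivity makes real.\<close>

lemma psd_sqrt_exists:
  assumes A: "psd A n"
  shows "\<exists>S. psd S n \<and> S * S = A"
proof -
  note Ac = psd_carrier[OF A]
  obtain w s where on: "\<And>i j. i < n \<Longrightarrow> j < n \<Longrightarrow> cinner n (w i) (w j) = (if i = j then 1 else 0)"
    and comp: "\<And>a b. a < n \<Longrightarrow> b < n \<Longrightarrow> (\<Sum>i<n. w i a * cnj (w i b)) = (if a = b then 1 else 0)"
    and ev: "\<And>i a. i < n \<Longrightarrow> a < n \<Longrightarrow> mat_app n A (w i) a = of_real (s i) * w i a"
    by (rule spectral_theorem[of n A, OF psd_hermitian[OF A]]) auto
  have s0: "0 \<le> s i" if "i < n" for i
    using psd_eigenvalue_nonneg[OF A, of "w i" "s i"] on[OF that that] ev[OF that] by simp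
  define S where "S = mat n n (\<lambda>(a,b). \<Sum>i<n. of_real (sqrt (s i)) * w i a * cnj (w i b))"
  have Sc: "S \<in> carrier_mat n n" by (simp add: S_def)
  have appS: "mat_app n S f a = (\<Sum>i<n. of_real (sqrt (s i)) * cinner n (w i) f * w i a)" if "a < n" for f a
  proof -
    have "mat_app n S f a = (\<Sum>b<n. \<Sum>i<n. of_real (sqrt (s i)) * w i a * cnj (w i b) * f b)"
      using that by (simp add: mat_app_def S_def sum_distrib_right)
    also have "\<dots> = (\<Sum>i<n. \<Sum>b<n. of_real (sqrt (s i)) * w i a * cnj (w i b) * f b)"
      by (rule sum.swap)
    finally show ?thesis by (simp add: cinner_def sum_distrib_left sum_distrib_right mult_ac)
  qed
  have "psd S n"
  proof (rule psdI[OF Sc])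
    show "S $$ (a,b) = cnj (S $$ (b,a))" if "a < n" "b < n" for a b
      using that by (simp add: S_def mult_ac)
    fix f
    have "cinner n f (mat_app n S f) = (\<Sum>i<n. of_real (sqrt (s i)) * cinner n (w i) f * cinner n f (w i))"
      unfolding cinner_sum_right[symmetric] by (rule cinner_cong) (simp_all add: appS)
    also have "\<dots> = of_real (\<Sum>i<n. sqrt (s i) * (cmod (cinner n (w i) f))\<^sup>2)"
      unfolding of_real_sum of_real_mult complex_norm_square cnj_cinner by (simp add: mult_ac)
    finally show "0 \<le> Re (cinner n f (mat_app n S f))"
      by (simp only: Re_complex_of_real) (intro sum_nonneg mult_nonneg_nonneg; simp add: s0)
  qed
  moreover have "S * S = A"
  proof (rule mat_eq_on_basis[OF _ Ac comp])
    fix i a assume i: "i < n" and a: "a < n"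
    have Sw: "mat_app n S (w i) b = of_real (sqrt (s i)) * w i b" if "b < n" for b
      using i by (simp add: appS[OF that] on if_distrib if_distribR cong: if_cong)
    have "mat_app n (S * S) (w i) a = mat_app n S (mat_app n S (w i)) a"
      using mat_app_mult[OF Sc Sc a] by simp
    also have "mat_app n S (mat_app n S (w i)) = mat_app n S (\<lambda>b. of_real (sqrt (s i)) * w i b)"
      by (rule mat_app_cong) (rule Sw)
    also have "\<dots> a = of_real (sqrt (s i)) * of_real (sqrt (s i)) * w i a"
      by (simp add: mat_app_scale Sw a)
    also have "complex_of_real (sqrt (s i)) * of_real (sqrt (s i)) = of_real (s i)"
      using s0[OF i] by (simp flip: of_real_mult)
    finally show "mat_app n (S * S) (w i) a = mat_app n A (w i) a" by (simp add: ev i a)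
  qed (use Sc in auto)
  ultimately show ?thesis by blast
qed

section \<open>Singular vectors and the trace norm of a sum of rank-one matrices\<close>

lemma cinner_mat_app_mat_app:
  assumes G: "G \<in> carrier_mat m k"
  shows "cinner m (mat_app k G f) (mat_app k G g) = cinner k f (mat_app k (adj G * G) g)"
proof -
  have "cinner k f (mat_app k (adj G * G) g) = cinner k f (mat_app m (adj G) (mat_app k G g))"
    by (rule cinner_cong) (simp_all add: mat_app_mult[OF adj_carrier[OF G] G])
  also have "\<dots> = cinner m (mat_app k G f) (mat_app k G g)"
    by (rule cinner_mat_app_adjoint) (simp add: adj_index[OF G])
  finally show ?thesis by simp
qed

lemma psd_adj_mult:
  assumes G: "G \<in> carrier_mat m k"
  shows "psd (adj G * G) k"
proof (rule psdI)
  show "adj G * G \<in> carrier_mat k k" using G adj_carrier[OF G] by auto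
  show "(adj G * G) $$ (a,b) = cnj ((adj G * G) $$ (b,a))" if "a < k" "b < k" for a b
    using that G adj_carrier[OF G] adj_index[OF G]
    by (auto simp: scalar_prod_def mult_ac intro!: sum.cong)
  show "0 \<le> Re (cinner k f (mat_app k (adj G * G) f))" for f
    unfolding cinner_mat_app_mat_app[OF G, symmetric] cinner_self by (simp add: sum_nonneg)
qed

text \<open>Existence and uniqueness of the root discharge the definite description once and for
  all.\<close>

lemma trace_norm_witness:
  assumes G: "G \<in> carrier_mat m k"
  obtains S where "psd S k" "S * S = adj G * G" "trace_norm G = Re (mtrace S)"
proof -
  obtain S where S: "psd S k" "S * S = adj G * G"
    using psd_sqrt_exists[OF psd_adj_mult[OF G]] by blast
  have dim: "dim_row (adj G * G) = k" using adj_carrier[OF G] by auto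
  have "psd_sqrt (adj G * G) = S"
    unfolding psd_sqrt_def dim by (rule the_equality) (use S psd_sqrt_unique in auto)
  then have "trace_norm G = Re (mtrace S)" by (simp add: trace_norm_def)
  with S show ?thesis by (rule that)
qed

text \<open>The trace norm is the sum of the singular values s i = <y i, G w i>. Inserting the
  rank-one decomposition of \<open>G\<close> turns each into a weighted sum of products of two
  coefficients, one of \<open>u j\<close> and one of \<open>v j\<close>. For fixed \<open>j\<close>,
  Cauchy-Schwarz over \<open>i\<close> and Bessel for each of the two orthonormal families give the
  product of the two lengths.\<close>

lemma trace_norm_sum_rank_one_le:
  fixes p :: "'j \<Rightarrow> real"
  assumes G: "G \<in> carrier_mat m k" and p: "\<And>j. j \<in> J \<Longrightarrow> 0 \<le> p j"
    and Geq: "\<And>r a. r < m \<Longrightarrow> a < k \<Longrightarrow> G $$ (r,a) = (\<Sum>j\<in>J. of_real (p j) * u j r * v j a)"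
  shows "trace_norm G \<le> (\<Sum>j\<in>J. p j * (L2_set (\<lambda>r. cmod (u j r)) {..<m} * L2_set (\<lambda>a. cmod (v j a)) {..<k}))"
proof -
  obtain S where S: "psd S k" and SS: "S * S = adj G * G" and tn: "trace_norm G = Re (mtrace S)"
    using trace_norm_witness[OF G] .
  note Sc = psd_carrier[OF S]
  obtain w s where on: "\<And>i j. i < k \<Longrightarrow> j < k \<Longrightarrow> cinner k (w i) (w j) = (if i = j then 1 else 0)"
    and ev: "\<And>i a. i < k \<Longrightarrow> a < k \<Longrightarrow> mat_app k S (w i) a = of_real (s i) * w i a"
    and Sab: "\<And>a b. a < k \<Longrightarrow> b < k \<Longrightarrow> S $$ (a,b) = (\<Sum>i<k. of_real (s i) * w i a * cnj (w i b))"
    by (rule spectral_theorem[of k S, OF psd_hermitian[OF S]]) auto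
  have s0: "0 \<le> s i" if "i < k" for i
    using psd_eigenvalue_nonneg[OF S, of "w i" "s i"] on[OF that that] ev[OF that] by simp
  have "mtrace S = (\<Sum>a<k. \<Sum>i<k. of_real (s i) * w i a * cnj (w i a))"
    using Sc by (auto simp: mtrace_def Sab)
  also have "\<dots> = (\<Sum>i<k. of_real (s i) * cinner k (w i) (w i))"
    unfolding cinner_def sum_distrib_left by (subst sum.swap) (simp add: mult_ac)
  finally have trS: "Re (mtrace S) = (\<Sum>i<k. s i)" by (simp add: on)
  \<comment> \<open>Left singular vectors are obtained by dividing by \<open>s i\<close>, so zero
    singular values are left out; they add nothing to the trace.\<close>
  define I where "I = {i. i < k \<and> s i \<noteq> 0}"
  have I: "finite I" "\<And>i. i \<in> I \<Longrightarrow> i < k \<and> s i > 0"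
    using s0 by (auto simp: I_def less_le)
  \<comment> \<open>The left singular vectors of G, with right singular vectors w and singular values s.\<close>
  define y where "y i r = of_real (1 / s i) * mat_app k G (w i) r" for i r
  \<comment> \<open>\<open>G\<close> maps the eigenvectors of \<open>S\<close> to orthogonal vectors
    whose lengths are the eigenvalues.\<close>
  have GG: "cinner m (mat_app k G (w i)) (mat_app k G (w j)) = of_real ((s j)\<^sup>2) * cinner k (w i) (w j)"
    if "i < k" "j < k" for i j
  proof -
    have "mat_app k (adj G * G) (w j) a = of_real ((s j)\<^sup>2) * w j a" if a: "a < k" for a
    proof -
      have "mat_app k (adj G * G) (w j) a = mat_app k S (mat_app k S (w j)) a"
        by (simp add: mat_app_mult[OF Sc Sc a] SS)
      also have "mat_app k S (mat_app k S (w j)) = mat_app k S (\<lambda>b. of_real (s j) * w j b)"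
        by (rule mat_app_cong) (simp add: ev \<open>j < k\<close>)
      finally show ?thesis by (simp add: mat_app_scale ev \<open>j < k\<close> a power2_eq_square)
    qed
    then have "cinner k (w i) (mat_app k (adj G * G) (w j)) = cinner k (w i) (\<lambda>a. of_real ((s j)\<^sup>2) * w j a)"
      by (intro cinner_cong) auto
    then show ?thesis unfolding cinner_mat_app_mat_app[OF G] cinner_scale_right .
  qed
  have yon: "cinner m (y i) (y j) = (if i = j then 1 else 0)" if "i \<in> I" "j \<in> I" for i j
    unfolding y_def cinner_scale_left cinner_scale_right
    using I(2)[OF that(1)] I(2)[OF that(2)] by (auto simp: GG on power2_eq_square)
  have s_eq: "of_real (s i) = (\<Sum>j\<in>J. of_real (p j) * cinner m (y i) (u j) * cinner k (\<lambda>a. cnj (w i a)) (v j))"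
    if "i \<in> I" for i
  proof -
    have i: "i < k" "s i > 0" using I(2)[OF that] by auto
    have Gw: "mat_app k G (w i) r = (\<Sum>j\<in>J. (of_real (p j) * cinner k (\<lambda>a. cnj (w i a)) (v j)) * u j r)" if r: "r < m" for r
    proof -
      have "mat_app k G (w i) r = (\<Sum>a<k. \<Sum>j\<in>J. of_real (p j) * u j r * v j a * w i a)"
        using r by (simp add: mat_app_def Geq sum_distrib_right)
      also have "\<dots> = (\<Sum>j\<in>J. \<Sum>a<k. of_real (p j) * u j r * v j a * w i a)" by (rule sum.swap)
      finally show ?thesis by (simp add: cinner_def sum_distrib_left sum_distrib_right mult_ac)
    qed
    have "cinner m (y i) (mat_app k G (w i)) = of_real (1 / s i) * of_real ((s i)\<^sup>2)"
      unfolding y_def cinner_scale_left using i by (simp add: GG on)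
    also have "\<dots> = of_real (1 / s i * (s i)\<^sup>2)" by (simp only: of_real_mult)
    also have "1 / s i * (s i)\<^sup>2 = s i" using i by (simp add: power2_eq_square)
    finally have "of_real (s i) = cinner m (y i) (mat_app k G (w i))" by simp
    also have "\<dots> = cinner m (y i) (\<lambda>r. \<Sum>j\<in>J. (of_real (p j) * cinner k (\<lambda>a. cnj (w i a)) (v j)) * u j r)"
      by (rule cinner_cong) (simp_all add: Gw)
    finally show ?thesis unfolding cinner_sum_right by (simp add: mult_ac)
  qed
  have "(\<Sum>i<k. s i) = (\<Sum>i\<in>I. s i)"
    by (rule sum.mono_neutral_right) (auto simp: I_def)
  also have "\<dots> \<le> (\<Sum>i\<in>I. \<Sum>j\<in>J. p j * (cmod (cinner m (y i) (u j)) * cmod (cinner k (\<lambda>a. cnj (w i a)) (v j))))"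
  proof (rule sum_mono)
    fix i assume i: "i \<in> I"
    have "s i = cmod (of_real (s i))" using I(2)[OF i] by simp
    also have "\<dots> \<le> (\<Sum>j\<in>J. cmod (of_real (p j) * cinner m (y i) (u j) * cinner k (\<lambda>a. cnj (w i a)) (v j)))"
      unfolding s_eq[OF i] by (rule norm_sum)
    also have "\<dots> = (\<Sum>j\<in>J. p j * (cmod (cinner m (y i) (u j)) * cmod (cinner k (\<lambda>a. cnj (w i a)) (v j))))"
      by (rule sum.cong) (simp_all add: norm_mult p)
    finally show "s i \<le> \<dots>" .
  qed
  also have "\<dots> = (\<Sum>j\<in>J. p j * (\<Sum>i\<in>I. cmod (cinner m (y i) (u j)) * cmod (cinner k (\<lambda>a. cnj (w i a)) (v j))))"
    unfolding sum_distrib_left by (rule sum.swap)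
  also have "\<dots> \<le> (\<Sum>j\<in>J. p j * (L2_set (\<lambda>r. cmod (u j r)) {..<m} * L2_set (\<lambda>a. cmod (v j a)) {..<k}))"
  proof (rule sum_mono, rule mult_left_mono)
    fix j
    let ?f = "\<lambda>i. cmod (cinner m (y i) (u j))" and ?g = "\<lambda>i. cmod (cinner k (\<lambda>a. cnj (w i a)) (v j))"
    have "(\<Sum>i\<in>I. ?f i * ?g i) \<le> L2_set ?f I * L2_set ?g I"
      using L2_set_mult_ineq[of ?f ?g I] by simp
    also have "\<dots> \<le> L2_set (\<lambda>r. cmod (u j r)) {..<m} * L2_set (\<lambda>a. cmod (v j a)) {..<k}"
    proof (rule mult_mono)
      show "L2_set ?f I \<le> L2_set (\<lambda>r. cmod (u j r)) {..<m}"
        unfolding L2_set_def by (intro real_sqrt_le_mono bessel[OF I(1)] yon)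
      \<comment> \<open>\<open>v j\<close> enters \<open>G\<close> without conjugation, so it is
        paired with the conjugates of the \<open>w i\<close>, which are again orthonormal.\<close>
      have "cinner k (\<lambda>a. cnj (w i a)) (\<lambda>a. cnj (w j a)) = (if i = j then 1 else 0)" if "i \<in> I" "j \<in> I" for i j
      proof -
        have "cinner k (\<lambda>a. cnj (w i a)) (\<lambda>a. cnj (w j a)) = cinner k (w j) (w i)"
          by (simp add: cinner_def mult.commute)
        then show ?thesis using on[of j i] I(2)[OF that(1)] I(2)[OF that(2)] by auto
      qed
      then show "L2_set ?g I \<le> L2_set (\<lambda>a. cmod (v j a)) {..<k}"
        unfolding L2_set_def by (intro real_sqrt_le_mono bessel[OF I(1)])
    qed (auto simp: L2_set_nonneg)
    finally show "(\<Sum>i\<in>I. ?f i * ?g i) \<le> L2_set (\<lambda>r. cmod (u j r)) {..<m} * L2_set (\<lambda>a. cmod (v j a)) {..<k}" .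
  qed (rule p)
  finally show ?thesis unfolding tn trS .
qed

section \<open>Traces of tensor products\<close>

lemma mdigit_Suc_last: "mdigit b (Suc n) c n = c mod b n"
  by (simp add: mdigit_def)

text \<open>A further party appends a least significant digit, so \<open>div\<close> and
  \<open>mod\<close> by the last radix peel it off.\<close>

lemma mdigit_Suc: "i < n \<Longrightarrow> mdigit b (Suc n) c i = mdigit b n (c div b n) i"
  by (simp add: mdigit_def mult.commute[of _ "b n"] div_mult2_eq)

lemma sum_div_mod:
  fixes f :: "nat \<Rightarrow> nat \<Rightarrow> 'a::comm_monoid_add"
  shows "(\<Sum>c<n * k. f (c div k) (c mod k)) = (\<Sum>a<n. \<Sum>b<k. f a b)"
proof -
  have "(\<Sum>c<n * k. f (c div k) (c mod k)) = (\<Sum>a<n. \<Sum>c\<in>{a * k..<a * k + k}. f (c div k) (c mod k))"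
    by (rule sum.nat_group[symmetric])
  also have "\<dots> = (\<Sum>a<n. \<Sum>b<k. f a b)"
  proof (rule sum.cong[OF refl])
    fix a
    have "(\<Sum>c\<in>{a * k..<a * k + k}. f (c div k) (c mod k)) = (\<Sum>b<k. f ((a * k + b) div k) ((a * k + b) mod k))"
      by (rule sum.reindex_bij_witness[of _ "\<lambda>b. a * k + b" "\<lambda>c. c - a * k"]) auto
    then show "(\<Sum>c\<in>{a * k..<a * k + k}. f (c div k) (c mod k)) = (\<Sum>b<k. f a b)" by simp
  qed
  finally show ?thesis .
qed

text \<open>The distributive law: \<open>c\<close> runs through all digit tuples exactly once. The
  general semiring covers the complex traces as well as the real squared moduli.\<close>

lemma sum_prod_mdigit:
  fixes f :: "nat \<Rightarrow> nat \<Rightarrow> 'a::comm_semiring_1"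
  shows "(\<Sum>c<(\<Prod>i<n. b i). \<Prod>i<n. f i (mdigit b n c i)) = (\<Prod>i<n. \<Sum>t<b i. f i t)"
proof (induction n)
  case (Suc n)
  have "(\<Sum>c<(\<Prod>i<Suc n. b i). \<Prod>i<Suc n. f i (mdigit b (Suc n) c i))
      = (\<Sum>c<(\<Prod>i<n. b i) * b n. (\<Prod>i<n. f i (mdigit b n (c div b n) i)) * f n (c mod b n))"
    by (simp add: mdigit_Suc mdigit_Suc_last)
  also have "\<dots> = (\<Sum>a<(\<Prod>i<n. b i). \<Sum>t<b n. (\<Prod>i<n. f i (mdigit b n a i)) * f n t)"
    by (rule sum_div_mod)
  also have "\<dots> = (\<Prod>i<Suc n. \<Sum>t<b i. f i t)"
    by (simp add: Suc.IH[symmetric] sum_product)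
  finally show ?case .
qed simp

text \<open>Both indices run over digit tuples, so \<open>sum_prod_mdigit\<close> factorises first
  the inner sum over columns and then the outer sum over rows.\<close>

lemma mtrace_tensor_mult:
  assumes "\<And>i. i < n \<Longrightarrow> F i \<in> carrier_mat (d i) (d i)" "\<And>i. i < n \<Longrightarrow> H i \<in> carrier_mat (d i) (d i)"
  shows "mtrace (tensor_mat n d F * tensor_mat n d H) = (\<Prod>i<n. mtrace (F i * H i))"
proof -
  let ?D = "\<Prod>i<n. d i"
  have "mtrace (tensor_mat n d F * tensor_mat n d H)
     = (\<Sum>r<?D. \<Sum>c<?D. tensor_mat n d F $$ (r,c) * tensor_mat n d H $$ (c,r))"
    by (rule mtrace_mult) (auto simp: tensor_mat_def)
  also have "\<dots> = (\<Sum>r<?D. \<Sum>c<?D. \<Prod>i<n. F i $$ (mdigit d n r i, mdigit d n c i) * H i $$ (mdigit d n c i, mdigit d n r i))"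
    by (simp add: tensor_mat_def prod.distrib)
  also have "\<dots> = (\<Sum>r<?D. \<Prod>i<n. \<Sum>t<d i. F i $$ (mdigit d n r i, t) * H i $$ (t, mdigit d n r i))"
    by (intro sum.cong refl) (rule sum_prod_mdigit[where f = "\<lambda>i t. F i $$ (mdigit d n _ i, t) * H i $$ (t, mdigit d n _ i)"])
  also have "\<dots> = (\<Prod>i<n. \<Sum>s<d i. \<Sum>t<d i. F i $$ (s,t) * H i $$ (t,s))"
    by (rule sum_prod_mdigit[where f = "\<lambda>i s. \<Sum>t<d i. F i $$ (s,t) * H i $$ (t,s)"])
  also have "\<dots> = (\<Prod>i<n. mtrace (F i * H i))"
    by (intro prod.cong refl) (simp add: mtrace_mult[OF assms])
  finally show ?thesis .
qed

text \<open>Through this, \<open>tau_vec\<close>, \<open>sigma_vec\<close> and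
  \<open>P_entry\<close> all become mixtures of products of local traces.\<close>

lemma mtrace_mult_separable:
  fixes p :: "nat \<Rightarrow> real"
  assumes F: "\<And>i. i < n \<Longrightarrow> F i \<in> carrier_mat (d i) (d i)"
    and R: "\<And>j i. j < m \<Longrightarrow> i < n \<Longrightarrow> R j i \<in> carrier_mat (d i) (d i)"
  shows "mtrace (tensor_mat n d F * mat (\<Prod>i<n. d i) (\<Prod>i<n. d i)
            (\<lambda>(r,c). \<Sum>j<m. of_real (p j) * tensor_mat n d (R j) $$ (r,c)))
         = (\<Sum>j<m. of_real (p j) * (\<Prod>i<n. mtrace (F i * R j i)))"
proof -
  let ?D = "\<Prod>i<n. d i"
  have T: "tensor_mat n d H \<in> carrier_mat ?D ?D" for H by (simp add: tensor_mat_def)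
  have "mtrace (tensor_mat n d F * mat ?D ?D (\<lambda>(r,c). \<Sum>j<m. of_real (p j) * tensor_mat n d (R j) $$ (r,c)))
     = (\<Sum>r<?D. \<Sum>c<?D. \<Sum>j<m. of_real (p j) * (tensor_mat n d F $$ (r,c) * tensor_mat n d (R j) $$ (c,r)))"
    by (subst mtrace_mult[OF T]) (auto simp: sum_distrib_left mult_ac intro!: sum.cong)
  also have "\<dots> = (\<Sum>r<?D. \<Sum>j<m. \<Sum>c<?D. of_real (p j) * (tensor_mat n d F $$ (r,c) * tensor_mat n d (R j) $$ (c,r)))"
    by (intro sum.cong refl sum.swap)
  also have "\<dots> = (\<Sum>j<m. \<Sum>r<?D. \<Sum>c<?D. of_real (p j) * (tensor_mat n d F $$ (r,c) * tensor_mat n d (R j) $$ (c,r)))"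
    by (rule sum.swap)
  also have "\<dots> = (\<Sum>j<m. of_real (p j) * mtrace (tensor_mat n d F * tensor_mat n d (R j)))"
    by (simp add: mtrace_mult[OF T T] sum_distrib_left)
  also have "\<dots> = (\<Sum>j<m. of_real (p j) * (\<Prod>i<n. mtrace (F i * R j i)))"
    by (intro sum.cong refl) (simp add: mtrace_tensor_mult F R)
  finally show ?thesis .
qed

section \<open>The index of coincidence of an informationally complete POVM\<close>

text \<open>On Hermitian arguments this is the Hilbert-Schmidt inner product. Leaving out the
  conjugation keeps it bilinear and symmetric, and function arguments let shifted operators be
  written pointwise.\<close>

definition trace_form :: "nat \<Rightarrow> (nat \<Rightarrow> nat \<Rightarrow> complex) \<Rightarrow> (nat \<Rightarrow> nat \<Rightarrow> complex) \<Rightarrow> complex" where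
  "trace_form d A B = (\<Sum>a<d. \<Sum>b<d. A a b * B b a)"

lemma trace_form_commute: "trace_form d A B = trace_form d B A"
  unfolding trace_form_def by (subst sum.swap) (simp add: mult.commute)

lemma trace_form_sum_left: "trace_form d (\<lambda>a b. \<Sum>i\<in>I. c i * F i a b) B = (\<Sum>i\<in>I. c i * trace_form d (F i) B)"
proof -
  have "trace_form d (\<lambda>a b. \<Sum>i\<in>I. c i * F i a b) B = (\<Sum>a<d. \<Sum>i\<in>I. \<Sum>b<d. c i * F i a b * B b a)"
    unfolding trace_form_def sum_distrib_right by (intro sum.cong refl sum.swap)
  also have "\<dots> = (\<Sum>i\<in>I. \<Sum>a<d. \<Sum>b<d. c i * F i a b * B b a)" by (rule sum.swap)
  finally show ?thesis by (simp add: trace_form_def sum_distrib_left mult.assoc)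
qed

lemma trace_form_diff_left: "trace_form d (\<lambda>a b. A a b - c * A' a b) B = trace_form d A B - c * trace_form d A' B"
  by (simp add: trace_form_def algebra_simps sum_subtractf sum_distrib_left)

lemma trace_form_diff_right: "trace_form d B (\<lambda>a b. A a b - c * A' a b) = trace_form d B A - c * trace_form d B A'"
  unfolding trace_form_commute[of d B] by (rule trace_form_diff_left)

lemma trace_form_self_hermitian:
  assumes "\<And>a b. a < d \<Longrightarrow> b < d \<Longrightarrow> A a b = cnj (A b a)"
  shows "trace_form d A A = of_real (\<Sum>a<d. \<Sum>b<d. (cmod (A a b))\<^sup>2)"
  unfolding trace_form_def of_real_sum complex_norm_square
  by (intro sum.cong refl) (metis assms lessThan_iff)

lemma trace_form_hermitian_real:
  assumes "\<And>a b. a < d \<Longrightarrow> b < d \<Longrightarrow> A a b = cnj (A b a)" "\<And>a b. a < d \<Longrightarrow> b < d \<Longrightarrow> B a b = cnj (B b a)"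
  shows "trace_form d A B = of_real (Re (trace_form d A B))"
proof -
  have "cnj (trace_form d A B) = trace_form d (\<lambda>a b. cnj (A a b)) (\<lambda>a b. cnj (B a b))" by (simp add: trace_form_def)
  also have "\<dots> = (\<Sum>a<d. \<Sum>b<d. A b a * B a b)"
    unfolding trace_form_def by (intro sum.cong refl arg_cong2[where f = "(*)"]) (metis assms lessThan_iff)+
  also have "\<dots> = trace_form d A B" unfolding trace_form_def by (rule sum.swap)
  finally show ?thesis by (metis Reals_cnj_iff of_real_Re)
qed

lemma mtrace_mult_trace_form:
  "A \<in> carrier_mat d d \<Longrightarrow> B \<in> carrier_mat d d \<Longrightarrow> mtrace (A * B) = trace_form d (\<lambda>a b. A $$ (a,b)) (\<lambda>a b. B $$ (a,b))"
  by (simp add: mtrace_mult trace_form_def)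

text \<open>The eigenvalues are nonnegative with sum 1, so each is at most 1 and squaring does not
  increase it.\<close>

lemma density_purity_le:
  assumes R: "density R d"
  shows "Re (trace_form d (\<lambda>a b. R $$ (a,b)) (\<lambda>a b. R $$ (a,b))) \<le> 1"
proof -
  have psd: "psd R d" and tr: "mtrace R = 1" using R by (auto simp: density_def)
  obtain w s where on: "\<And>i j. i < d \<Longrightarrow> j < d \<Longrightarrow> cinner d (w i) (w j) = (if i = j then 1 else 0)"
    and ev: "\<And>i a. i < d \<Longrightarrow> a < d \<Longrightarrow> mat_app d R (w i) a = of_real (s i) * w i a"
    and Rab: "\<And>a b. a < d \<Longrightarrow> b < d \<Longrightarrow> R $$ (a,b) = (\<Sum>i<d. of_real (s i) * w i a * cnj (w i b))"
    by (rule spectral_theorem[of d R, OF psd_hermitian[OF psd]]) auto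
  have s0: "0 \<le> s i" if "i < d" for i
    using psd_eigenvalue_nonneg[OF psd, of "w i" "s i"] on[OF that that] ev[OF that] by simp
  have "mtrace R = (\<Sum>a<d. \<Sum>i<d. of_real (s i) * w i a * cnj (w i a))"
    using psd_carrier[OF psd] by (auto simp: mtrace_def Rab)
  also have "\<dots> = (\<Sum>i<d. of_real (s i) * cinner d (w i) (w i))"
    unfolding cinner_def sum_distrib_left by (subst sum.swap) (simp add: mult_ac)
  finally have "of_real (\<Sum>i<d. s i) = (1::complex)" using tr by (simp add: on)
  then have sum1: "(\<Sum>i<d. s i) = 1" by (metis of_real_eq_1_iff)
  let ?R = "\<lambda>a b. R $$ (a,b)"
  have "trace_form d ?R ?R = trace_form d (\<lambda>a b. \<Sum>i<d. of_real (s i) * (w i a * cnj (w i b))) ?R"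
    unfolding trace_form_def by (intro sum.cong refl arg_cong2[where f = "(*)"]) (simp add: Rab mult.assoc)
  \<comment> \<open>The form of a rank-one projector with \<open>R\<close> is the expectation of
    \<open>R\<close> in its vector.\<close>
  also have "\<dots> = (\<Sum>i<d. of_real (s i) * cinner d (w i) (mat_app d R (w i)))"
    unfolding trace_form_sum_left
    by (intro sum.cong refl arg_cong2[where f = "(*)"], unfold trace_form_def cinner_def mat_app_def sum_distrib_left)
       (subst sum.swap, simp add: mult_ac)
  also have "\<dots> = (\<Sum>i<d. of_real (s i) * of_real (s i))"
  proof (intro sum.cong refl arg_cong2[where f = "(*)"])
    fix i assume "i \<in> {..<d}"
    then have i: "i < d" by simp
    have "cinner d (w i) (mat_app d R (w i)) = cinner d (w i) (\<lambda>a. of_real (s i) * w i a)"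
      by (rule cinner_cong) (simp_all add: ev i)
    then show "cinner d (w i) (mat_app d R (w i)) = of_real (s i)" by (simp add: cinner_scale_right on i)
  qed
  finally have "Re (trace_form d ?R ?R) = (\<Sum>i<d. s i * s i)" by simp
  also have "\<dots> \<le> (\<Sum>i<d. s i)"
  proof (rule sum_mono)
    fix i assume i: "i \<in> {..<d}"
    have "s i \<le> (\<Sum>i<d. s i)" by (rule member_le_sum) (use i s0 in auto)
    then show "s i * s i \<le> s i" using sum1 s0[of i] i by (simp add: mult_left_le)
  qed
  finally show ?thesis unfolding sum1 .
qed

lemma index_of_coincidence_le:
  assumes povm: "IC_NM_POVM d N M x E" and R: "density R d"
  shows "(\<Sum>t<N * M. (cmod (mtrace (E (t div M) (t mod M) * R)))\<^sup>2) \<le> Kconst d M x"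
proof -
  have nm: "NM_POVM d N M x E" and NM: "N * (M - 1) = d ^ 2 - 1"
    using povm by (auto simp: IC_NM_POVM_def)
  note nm' = nm[unfolded NM_POVM_def]
  note pov = nm'[THEN conjunct2, THEN conjunct2, THEN conjunct2]
  note tr1 = pov[THEN conjunct2]
  note tr2 = tr1[THEN conjunct2]
  note tr3 = tr2[THEN conjunct2]
  note psdE = pov[THEN conjunct1, rule_format, THEN conjunct1, rule_format]
    and sumE = pov[THEN conjunct1, rule_format, THEN conjunct2, rule_format]
    and trE = tr1[THEN conjunct1, rule_format]
    and trEE = tr2[THEN conjunct1, rule_format]
    and trEE' = tr3[THEN conjunct1, rule_format]
    and trEF = tr3[THEN conjunct2, rule_format]
  have M: "M \<ge> 2" and x: "real d / real M ^ 2 < x" "x \<le> real d ^ 2 / real M ^ 2"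
    using nm' by simp_all
  \<comment> \<open>The interval allowed for \<open>x\<close> is empty in dimensions 0 and
    1.\<close>
  have d1: "d \<ge> 2"
  proof -
    have "real d / real M ^ 2 < real d ^ 2 / real M ^ 2" using x by linarith
    then have "real d < real d ^ 2" using M by (simp add: divide_less_cancel)
    then have "d \<noteq> 0 \<and> d \<noteq> 1" by (intro conjI notI) simp_all
    then show ?thesis by simp
  qed
  define \<delta> :: "nat \<Rightarrow> nat \<Rightarrow> complex" where "\<delta> a b = (if a = b then 1 else 0)" for a b
  define e where "e \<alpha> k a b = E \<alpha> k $$ (a,b)" for \<alpha> k a b
  define r where "r a b = R $$ (a,b)" for a b
  have psdR: "psd R d" and trR: "mtrace R = 1" using R by (auto simp: density_def)
  have trace_form_\<delta>: "trace_form d \<delta> A = (\<Sum>a<d. A a a)" for A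
    unfolding trace_form_def \<delta>_def by (intro sum.cong refl) (simp add: if_distrib[where f = "\<lambda>z. z * _"] cong: if_cong)
  have e\<delta>: "trace_form d \<delta> (e \<alpha> k) = of_real (real d / real M)" if "\<alpha> < N" "k < M" for \<alpha> k
    using trE[OF that] psd_carrier[OF psdE[OF that]] by (auto simp: trace_form_\<delta> e_def mtrace_def)
  have r\<delta>: "trace_form d \<delta> r = 1"
    using trR psd_carrier[OF psdR] by (auto simp: trace_form_\<delta> r_def mtrace_def)
  have \<delta>\<delta>: "trace_form d \<delta> \<delta> = of_nat d" by (simp add: trace_form_\<delta>) (simp add: \<delta>_def)
  have e_herm: "e \<alpha> k a b = cnj (e \<alpha> k b a)" if "\<alpha> < N" "k < M" "a < d" "b < d" for \<alpha> k a b
    unfolding e_def by (rule psd_hermitian[OF psdE]) (use that in auto)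
  have r_herm: "r a b = cnj (r b a)" if "a < d" "b < d" for a b
    unfolding r_def by (rule psd_hermitian[OF psdR]) (use that in auto)
  define p where "p \<alpha> k = Re (trace_form d (e \<alpha> k) r)" for \<alpha> k
  have p: "trace_form d (e \<alpha> k) r = of_real (p \<alpha> k)" if "\<alpha> < N" "k < M" for \<alpha> k
    unfolding p_def by (rule trace_form_hermitian_real, rule e_herm[OF that], assumption+, rule r_herm, assumption+)
  have tr_p: "mtrace (E \<alpha> k * R) = of_real (p \<alpha> k)" if "\<alpha> < N" "k < M" for \<alpha> k
    using p[OF that] mtrace_mult_trace_form[OF psd_carrier[OF psdE[OF that]] psd_carrier[OF psdR]]
    by (simp add: e_def[abs_def] r_def[abs_def])
  have sum_p: "(\<Sum>k<M. p \<alpha> k) = 1" if \<alpha>: "\<alpha> < N" for \<alpha>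
  proof -
    have "of_real (\<Sum>k<M. p \<alpha> k) = (\<Sum>k<M. 1 * trace_form d (e \<alpha> k) r)" by (simp add: p \<alpha>)
    also have "\<dots> = trace_form d (\<lambda>a b. \<Sum>k<M. 1 * e \<alpha> k a b) r" by (rule trace_form_sum_left[symmetric])
    also have "\<dots> = trace_form d \<delta> r"
      unfolding trace_form_def by (intro sum.cong refl arg_cong2[where f = "(*)"]) (simp add: e_def \<delta>_def sumE \<alpha>)
    finally show ?thesis using r\<delta> by (metis of_real_eq_1_iff)
  qed
  \<comment> \<open>\<open>F\<close> and \<open>r'\<close> are the traceless parts, since tr E = d/M
    and tr R = 1; \<open>t\<close> is the deviation of a probability from the uniform value
    1/M.\<close>
  define F where "F \<alpha> k a b = e \<alpha> k a b - of_real (1 / real M) * \<delta> a b" for \<alpha> k a b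
  define r' where "r' a b = r a b - of_real (1 / real d) * \<delta> a b" for a b
  define t where "t \<alpha> k = p \<alpha> k - 1 / real M" for \<alpha> k
  have F_herm: "F \<alpha> k a b = cnj (F \<alpha> k b a)" if "\<alpha> < N" "k < M" "a < d" "b < d" for \<alpha> k a b
    unfolding F_def by (subst e_herm[OF that]) (simp add: \<delta>_def)
  have r'_herm: "r' a b = cnj (r' b a)" if "a < d" "b < d" for a b
    unfolding r'_def by (subst r_herm[OF that]) (simp add: \<delta>_def)
  have Mpos: "real M > 0" and dpos: "real d > 0" using M d1 by auto
  have Fr': "trace_form d (F \<alpha> k) r' = of_real (t \<alpha> k)" if "\<alpha> < N" "k < M" for \<alpha> k
    unfolding F_def[abs_def] r'_def[abs_def] trace_form_diff_left trace_form_diff_right t_def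
      trace_form_commute[of d "e \<alpha> k" \<delta>] e\<delta>[OF that] r\<delta> \<delta>\<delta> p[OF that]
    using Mpos dpos by (simp add: field_simps)
  \<comment> \<open>The squared Hilbert-Schmidt norm of each \<open>F\<close>. Within one
    measurement the elements \<open>F\<close> sum to zero, which fits the inner product - g / (M -
    1) between distinct ones.\<close>
  define g where "g = x - real d / real M ^ 2"
  have gpos: "g > 0" using x by (simp add: g_def)
  have FF: "trace_form d (F \<alpha> k) (F \<beta> l) = of_real (if \<alpha> = \<beta> then if k = l then g else - g / (real M - 1) else 0)"
    if i: "\<alpha> < N" "k < M" and j: "\<beta> < N" "l < M" for \<alpha> k \<beta> l
  proof -
    have "trace_form d (F \<alpha> k) (F \<beta> l) = trace_form d (e \<alpha> k) (e \<beta> l) - of_real (real d / real M ^ 2)"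
      unfolding F_def[abs_def] trace_form_diff_left trace_form_diff_right trace_form_commute[of d "e \<alpha> k" \<delta>] e\<delta>[OF i] e\<delta>[OF j] \<delta>\<delta>
      using Mpos by (simp add: field_simps power2_eq_square)
    also have "trace_form d (e \<alpha> k) (e \<beta> l) = mtrace (E \<alpha> k * E \<beta> l)"
      by (simp add: mtrace_mult_trace_form[OF psd_carrier[OF psdE[OF i]] psd_carrier[OF psdE[OF j]]] e_def[abs_def])
    also have "\<dots> = of_real (if \<alpha> = \<beta> then if k = l then x else (real d - real M * x) / (real M * (real M - 1)) else real d / real M ^ 2)"
    proof -
      consider "\<alpha> = \<beta>" "k = l" | "\<alpha> = \<beta>" "l \<noteq> k" | "\<beta> \<noteq> \<alpha>" by blast
      then show ?thesis
      proof cases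
        case 1 then show ?thesis using trEE[OF i] by simp
      next
        case 2
        then show ?thesis using trEE'[OF i j(2)] by simp
      next
        case 3
        then show ?thesis using trEF[OF i(1) j(1) _ i(2) j(2)] by simp
      qed
    qed
    also have "\<dots> - of_real (real d / real M ^ 2)
        = of_real (if \<alpha> = \<beta> then if k = l then g else - g / (real M - 1) else 0)"
      unfolding of_real_diff[symmetric] of_real_eq_iff using M
      by (auto simp: g_def field_simps power2_eq_square)
    finally show ?thesis .
  qed
  define I where "I = {..<N} \<times> {..<M}"
  \<comment> \<open>c = g + g / (M - 1): the Gram matrix of one measurement is c times the identity
    minus g / (M - 1) times the all-ones matrix, so it multiplies a coefficient vector of sum zero
    by \<open>c\<close>.\<close>
  define c where "c = g * real M / (real M - 1)"
  have cpos: "c > 0" using gpos M by (simp add: c_def)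
  \<comment> \<open>The \<open>F\<close> are linearly dependent, so \<open>bessel\<close> does not
    apply to them directly. The coefficients \<open>t\<close> sum to zero in each measurement and
    hence form an eigenvector of the Gram matrix, which makes the projection explicit.\<close>
  define Y where "Y a b = (\<Sum>i\<in>I. of_real (t (fst i) (snd i)) * F (fst i) (snd i) a b)" for a b
  define T where "T = (\<Sum>i\<in>I. (t (fst i) (snd i))\<^sup>2)"
  have YY: "trace_form d Y B = (\<Sum>i\<in>I. of_real (t (fst i) (snd i)) * trace_form d (F (fst i) (snd i)) B)" for B
    unfolding Y_def[abs_def] by (rule trace_form_sum_left)
  have Yr': "trace_form d Y r' = of_real T"
    unfolding YY T_def of_real_sum by (rule sum.cong) (auto simp: I_def Fr' power2_eq_square)
  have sum_t: "(\<Sum>k<M. t \<alpha> k) = 0" if "\<alpha> < N" for \<alpha>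
    using sum_p[OF that] Mpos by (simp add: t_def sum_subtractf)
  have YF: "trace_form d Y (F \<alpha> k) = of_real (c * t \<alpha> k)" if i: "\<alpha> < N" "k < M" for \<alpha> k
  proof -
    have "trace_form d Y (F \<alpha> k) = (\<Sum>\<beta><N. \<Sum>l<M. of_real (t \<beta> l * (if \<beta> = \<alpha> then if l = k then g else - g / (real M - 1) else 0)))"
      unfolding YY I_def sum.cartesian_product' of_real_mult
      by (rule sum.cong) (auto simp: FF i)
    also have "\<dots> = of_real (\<Sum>\<beta><N. \<Sum>l<M. t \<beta> l * (if \<beta> = \<alpha> then if l = k then g else - g / (real M - 1) else 0))"
      by simp
    also have "(\<Sum>\<beta><N. \<Sum>l<M. t \<beta> l * (if \<beta> = \<alpha> then if l = k then g else - g / (real M - 1) else 0))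
      = (\<Sum>\<beta><N. if \<beta> = \<alpha> then \<Sum>l<M. t \<alpha> l * (if l = k then g else - g / (real M - 1)) else 0)"
      by (rule sum.cong) auto
    also have "\<dots> = (\<Sum>l<M. t \<alpha> l * (if l = k then g else - g / (real M - 1)))"
      using i by simp
    also have "\<dots> = (\<Sum>l<M. (if l = k then c * t \<alpha> l else 0) - g / (real M - 1) * t \<alpha> l)"
      by (rule sum.cong) (use M in \<open>auto simp: c_def field_simps\<close>)
    also have "\<dots> = c * t \<alpha> k"
      using i sum_t[OF i(1)] by (simp add: sum_subtractf sum_distrib_left[symmetric] sum_divide_distrib[symmetric])
    finally show ?thesis .
  qed
  have YYc: "trace_form d Y Y = of_real (c * T)"
    unfolding YY T_def sum_distrib_left of_real_sum
    by (rule sum.cong) (auto simp: I_def trace_form_commute[of d _ Y] YF power2_eq_square)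
  \<comment> \<open>Y / c is the orthogonal projection of r' onto the span of the F, so tr (Z Z) \<ge> 0 is Bessel's inequality.\<close>
  define Z where "Z a b = r' a b - of_real (1 / c) * Y a b" for a b
  have Z_herm: "Z a b = cnj (Z b a)" if "a < d" "b < d" for a b
  proof -
    have "Y a b = cnj (Y b a)"
      unfolding Y_def cnj_sum complex_cnj_mult complex_cnj_complex_of_real
      by (intro sum.cong refl arg_cong2[where f = "(*)"] F_herm) (use that in \<open>auto simp: I_def\<close>)
    then show ?thesis unfolding Z_def using r'_herm[OF that] by simp
  qed
  \<comment> \<open>The identity component split off from \<open>r\<close> has squared norm 1/d and
    is orthogonal to \<open>r'\<close>.\<close>
  have r'r': "trace_form d r' r' = trace_form d r r - of_real (1 / real d)"
    unfolding r'_def[abs_def] trace_form_diff_left trace_form_diff_right trace_form_commute[of d r \<delta>] r\<delta> \<delta>\<delta>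
    using dpos by (simp add: field_simps)
  have "Re (trace_form d r r) \<le> 1" using density_purity_le[OF R] by (simp add: r_def[abs_def])
  then have r'1: "Re (trace_form d r' r') \<le> 1 - 1 / real d" unfolding r'r' by simp
  have "trace_form d Z Z = trace_form d r' r' - of_real (T / c)"
    unfolding Z_def[abs_def] trace_form_diff_left trace_form_diff_right trace_form_commute[of d r' Y] Yr' YYc
    using cpos by (simp add: field_simps)
  then have "Re (trace_form d Z Z) = Re (trace_form d r' r') - T / c" by simp
  moreover have "Re (trace_form d Z Z) \<ge> 0"
  proof -
    have "trace_form d Z Z = of_real (\<Sum>a<d. \<Sum>b<d. (cmod (Z a b))\<^sup>2)"
      by (rule trace_form_self_hermitian) (rule Z_herm)
    then have "Re (trace_form d Z Z) = (\<Sum>a<d. \<Sum>b<d. (cmod (Z a b))\<^sup>2)"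
      by (simp only: Re_complex_of_real)
    then show ?thesis by (simp add: sum_nonneg)
  qed
  ultimately have "T / c \<le> 1 - 1 / real d" using r'1 by simp
  then have T: "T \<le> c * (1 - 1 / real d)" using cpos by (simp add: field_simps)
  have "(\<Sum>t<N * M. (cmod (mtrace (E (t div M) (t mod M) * R)))\<^sup>2) = (\<Sum>\<alpha><N. \<Sum>k<M. (cmod (mtrace (E \<alpha> k * R)))\<^sup>2)"
    by (rule sum_div_mod)
  \<comment> \<open>Square of t + 1/M. The cross terms cancel within each measurement, and the
    constants add up to N/M.\<close>
  also have "\<dots> = (\<Sum>\<alpha><N. \<Sum>k<M. (t \<alpha> k)\<^sup>2 + 2 / real M * t \<alpha> k + 1 / real M ^ 2)"
    by (intro sum.cong refl) (use Mpos in \<open>simp add: tr_p t_def power2_eq_square field_simps\<close>)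
  also have "\<dots> = (\<Sum>\<alpha><N. (\<Sum>k<M. (t \<alpha> k)\<^sup>2) + 1 / real M)"
    by (intro sum.cong refl)
      (use Mpos in \<open>simp add: sum.distrib sum_distrib_left[symmetric] sum_divide_distrib[symmetric] sum_t power2_eq_square\<close>)
  also have "\<dots> = T + real N / real M"
    unfolding T_def I_def sum.cartesian_product' by (simp add: sum.distrib)
  also have "\<dots> \<le> c * (1 - 1 / real d) + real N / real M" using T by simp
  also have "\<dots> = Kconst d M x"
  proof -
    \<comment> \<open>The lower bounds on \<open>M\<close> and \<open>d\<close> make the truncated
      subtractions exact.\<close>
    have "real N * (real M - 1) = real d ^ 2 - 1"
    proof -
      have "real (N * (M - 1)) = real (d ^ 2 - 1)" using NM by simp
      then show ?thesis using M d1 by (simp add: of_nat_diff)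
    qed
    then have N: "real N = (real d ^ 2 - 1) / (real M - 1)" using M by (simp add: field_simps)
    \<comment> \<open>The identity is proved for free nonzero reals, with \<open>k\<close> standing
      for M - 1, so that clearing denominators never meets a difference.\<close>
    have "(x - D / m ^ 2) * m / k * (1 - 1 / D) + (D ^ 2 - 1) / k / m = (D - 1) * (D ^ 2 + m ^ 2 * x) / (D * m * k)"
      if "D \<noteq> 0" "m \<noteq> 0" "k \<noteq> 0" for D m k :: real
      using that by (simp add: field_simps power2_eq_square)
    from this[of "real d" "real M" "real M - 1"] show ?thesis
      unfolding Kconst_def c_def g_def N using M dpos by simp
  qed
  finally show ?thesis .
qed

section \<open>The separability criterion\<close>

lemma sum_lessThan_add:
  fixes f :: "nat \<Rightarrow> 'a::comm_monoid_add"
  shows "(\<Sum>r<l + k. f r) = (\<Sum>r<l. f r) + (\<Sum>t<k. f (l + t))"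
  by (induction k) (simp_all add: add.assoc)

lemma mdigit_less:
  assumes "c < (\<Prod>i<n. b i)" "i < n"
  shows "mdigit b n c i < b i"
proof -
  have "b i \<noteq> 0"
  proof
    assume "b i = 0"
    then have "(\<Prod>i<n. b i) = 0" using assms(2) by (intro prod_zero) auto
    then show False using assms(1) by (metis not_less_zero)
  qed
  then show ?thesis by (simp add: mdigit_def)
qed

theorem theorem3:
  fixes n :: nat and d N M :: "nat \<Rightarrow> nat" and x :: "nat \<Rightarrow> real"
    and E :: "nat \<Rightarrow> nat \<Rightarrow> nat \<Rightarrow> complex mat" and \<rho> :: "complex mat"
    and \<mu> \<nu> :: real and l q :: nat
  assumes state: "density \<rho> (\<Prod>i<n. d i)"
    and povm: "\<forall>i<n. IC_NM_POVM (d i) (N i) (M i) (x i) (E i)"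
    and l: "l \<ge> 1"
    and sep: "fully_separable n d \<rho>"
    and q: "q < n"
  shows "trace_norm (Mlmat n d N M E \<rho> q l \<mu> \<nu>)
     \<le> sqrt ((real l * \<mu>\<^sup>2 + Kconst (d q) (M q) (x q)) *
             (real l * \<nu>\<^sup>2 + (\<Prod>i\<in>{..<n} - {q}. Kconst (d i) (M i) (x i))))"
proof -
  obtain m R and p :: "nat \<Rightarrow> real" where p0: "\<forall>j<m. 0 \<le> p j" and p1: "(\<Sum>j<m. p j) = 1"
    and R: "\<forall>j<m. \<forall>i<n. density (R j i) (d i)"
    and \<rho>: "\<rho> = mat (\<Prod>i<n. d i) (\<Prod>i<n. d i)
               (\<lambda>(r,c). \<Sum>j<m. of_real (p j) * tensor_mat n d (R j) $$ (r,c))"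
    using sep unfolding fully_separable_def by blast
  have Rc: "R j i \<in> carrier_mat (d i) (d i)" and Rtr: "mtrace (1\<^sub>m (d i) * R j i) = 1" if "j < m" "i < n" for j i
  proof -
    have "psd (R j i) (d i)" "mtrace (R j i) = 1" using R that by (auto simp: density_def)
    then show "R j i \<in> carrier_mat (d i) (d i)" "mtrace (1\<^sub>m (d i) * R j i) = 1"
      by (auto dest: psd_carrier)
  qed
  have Ec: "E i (t div M i) (t mod M i) \<in> carrier_mat (d i) (d i)" if "i < n" "t < N i * M i" for i t
  proof -
    have nm: "NM_POVM (d i) (N i) (M i) (x i) (E i)" using povm that by (auto simp: IC_NM_POVM_def)
    have "t div M i < N i" "t mod M i < M i"
      using that(2) by (simp add: less_mult_imp_div_less, cases "M i = 0") auto
    then have "psd (E i (t div M i) (t mod M i)) (d i)" using nm by (simp add: NM_POVM_def)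
    then show ?thesis by (rule psd_carrier)
  qed
  let ?b = "col_radix N M q"
  let ?C = "\<Prod>i<n. ?b i"
  define g where "g j i t = mtrace (E i (t div M i) (t mod M i) * R j i)" for j i t
  \<comment> \<open>The factor 1 at \<open>q\<close> is the trace of the local state there and goes
    with the radix 1 of the suppressed digit, so products may range over all parties.\<close>
  define \<sigma> where "\<sigma> j c = (\<Prod>i<n. if i = q then 1 else g j i (mdigit ?b n c i))" for j c
  have colc: "col_op n d N M E q c i \<in> carrier_mat (d i) (d i)" if "i < n" "i \<noteq> q" "c < ?C" for i c
  proof -
    have "?b i = N i * M i" using that by (simp add: col_radix_def)
    then have "mdigit ?b n c i < N i * M i" using mdigit_less[OF that(3,1)] by simp
    then show ?thesis using Ec[OF that(1)] by (simp add: col_op_def Let_def)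
  qed
  have col_g: "mtrace (col_op n d N M E q c i * R j i) = g j i (mdigit ?b n c i)" for i j c
    by (simp add: col_op_def Let_def g_def)
  have split_q: "(\<Prod>i<n. if i = q then a else f i) = a * (\<Prod>i<n. if i = q then 1 else f i)"
    for a :: complex and f
  proof -
    have "(\<Prod>i<n. if i = q then a else f i) = (\<Prod>i<n. (if i = q then a else 1) * (if i = q then 1 else f i))"
      by (rule prod.cong) auto
    also have "\<dots> = (\<Prod>i<n. if i = q then a else 1) * (\<Prod>i<n. if i = q then 1 else f i)"
      by (rule prod.distrib)
    finally show ?thesis using q by simp
  qed
  have tau: "tau_vec n d N M E \<rho> q r = (\<Sum>j<m. of_real (p j) * g j q r)" if "r < N q * M q" for r
  proof -
    have "tau_vec n d N M E \<rho> q r = (\<Sum>j<m. of_real (p j) *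
        (\<Prod>i<n. mtrace ((if i = q then E q (r div M q) (r mod M q) else 1\<^sub>m (d i)) * R j i)))"
      unfolding tau_vec_def \<rho> using Ec[OF q that] by (intro mtrace_mult_separable Rc) auto
    also have "\<dots> = (\<Sum>j<m. of_real (p j) * g j q r)"
    proof (intro sum.cong refl arg_cong2[where f = "(*)"])
      fix j assume "j \<in> {..<m}"
      then have "(\<Prod>i<n. mtrace ((if i = q then E q (r div M q) (r mod M q) else 1\<^sub>m (d i)) * R j i))
          = (\<Prod>i<n. if i = q then g j q r else 1)"
        by (intro prod.cong refl) (auto simp: g_def Rtr)
      then show "(\<Prod>i<n. mtrace ((if i = q then E q (r div M q) (r mod M q) else 1\<^sub>m (d i)) * R j i)) = g j q r"
        using q by simp
    qed
    finally show ?thesis .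
  qed
  have sigma: "sigma_vec n d N M E \<rho> q c = (\<Sum>j<m. of_real (p j) * \<sigma> j c)" if "c < ?C" for c
  proof -
    have "sigma_vec n d N M E \<rho> q c = (\<Sum>j<m. of_real (p j) *
        (\<Prod>i<n. mtrace ((if i = q then 1\<^sub>m (d q) else col_op n d N M E q c i) * R j i)))"
      unfolding sigma_vec_def \<rho> using colc[OF _ _ that] by (intro mtrace_mult_separable Rc) auto
    also have "\<dots> = (\<Sum>j<m. of_real (p j) * \<sigma> j c)"
      unfolding \<sigma>_def using q
      by (intro sum.cong refl arg_cong2[where f = "(*)"] prod.cong) (auto simp: col_g Rtr)
    finally show ?thesis .
  qed
  have P: "P_entry n d N M E \<rho> q r c = (\<Sum>j<m. of_real (p j) * g j q r * \<sigma> j c)"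
    if "r < N q * M q" "c < ?C" for r c
  proof -
    have "P_entry n d N M E \<rho> q r c = (\<Sum>j<m. of_real (p j) *
        (\<Prod>i<n. mtrace ((if i = q then E q (r div M q) (r mod M q) else col_op n d N M E q c i) * R j i)))"
      unfolding P_entry_def \<rho> using colc[OF _ _ that(2)] Ec[OF q that(1)]
      by (intro mtrace_mult_separable Rc) auto
    also have "\<dots> = (\<Sum>j<m. of_real (p j) * (\<Prod>i<n. if i = q then g j q r else g j i (mdigit ?b n c i)))"
      by (intro sum.cong refl arg_cong2[where f = "(*)"] prod.cong) (auto simp: col_g g_def[of _ q r])
    finally show ?thesis by (subst (asm) split_q) (simp add: \<sigma>_def mult.assoc)
  qed
  define u where "u j r = (if r < l then of_real \<mu> else g j q (r - l))" for j r
  define v where "v j c = (if c < l then of_real \<nu> else \<sigma> j (c - l))" for j c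
  let ?G = "Mlmat n d N M E \<rho> q l \<mu> \<nu>"
  let ?A = "real l * \<mu>\<^sup>2 + Kconst (d q) (M q) (x q)"
  let ?B = "real l * \<nu>\<^sup>2 + (\<Prod>i\<in>{..<n} - {q}. Kconst (d i) (M i) (x i))"
  \<comment> \<open>Needed for the corner block, whose constant entry has to be written as an
    average with the weights \<open>p\<close>.\<close>
  have p1': "(\<Sum>j<m. complex_of_real (p j)) = 1" using p1 by (simp flip: of_real_sum)
  have "trace_norm ?G \<le> (\<Sum>j<m. p j * (L2_set (\<lambda>r. cmod (u j r)) {..<l + N q * M q} * L2_set (\<lambda>c. cmod (v j c)) {..<l + ?C}))"
  proof (rule trace_norm_sum_rank_one_le)
    show "?G \<in> carrier_mat (l + N q * M q) (l + ?C)" by (simp add: Mlmat_def)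
    show "0 \<le> p j" if "j \<in> {..<m}" for j using p0 that by simp
    show "?G $$ (r,c) = (\<Sum>j<m. of_real (p j) * u j r * v j c)" if "r < l + N q * M q" "c < l + ?C" for r c
    proof -
      have "r - l < N q * M q" if "\<not> r < l" using that \<open>r < l + N q * M q\<close> by simp
      moreover have "c - l < ?C" if "\<not> c < l" using that \<open>c < l + ?C\<close> by simp
      moreover have "(\<Sum>j<m. complex_of_real (p j) * of_real \<mu> * of_real \<nu>) = of_real (\<mu> * \<nu>)"
        using p1' by (simp flip: sum_distrib_right)
      ultimately show ?thesis
        using that by (auto simp: Mlmat_def u_def v_def tau sigma P sum_distrib_left mult_ac)
    qed
  qed
  also have "\<dots> \<le> (\<Sum>j<m. p j * (sqrt ?A * sqrt ?B))"
  proof (rule sum_mono, rule mult_left_mono)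
    fix j assume j: "j \<in> {..<m}"
    have K: "(\<Sum>t<N i * M i. (cmod (g j i t))\<^sup>2) \<le> Kconst (d i) (M i) (x i)" if "i < n" for i
      unfolding g_def by (rule index_of_coincidence_le) (use povm R j that in auto)
    have "(\<Sum>r<l + N q * M q. (cmod (u j r))\<^sup>2) = real l * \<mu>\<^sup>2 + (\<Sum>t<N q * M q. (cmod (g j q t))\<^sup>2)"
      unfolding sum_lessThan_add by (simp add: u_def)
    also have "\<dots> \<le> ?A" using K[OF q] by simp
    finally have u_le: "L2_set (\<lambda>r. cmod (u j r)) {..<l + N q * M q} \<le> sqrt ?A"
      unfolding L2_set_def by (rule real_sqrt_le_mono)
    have "(\<Sum>c<?C. (cmod (\<sigma> j c))\<^sup>2) = (\<Sum>c<?C. \<Prod>i<n. if i = q then 1 else (cmod (g j i (mdigit ?b n c i)))\<^sup>2)"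
      unfolding \<sigma>_def prod_norm[symmetric] prod_power_distrib
      by (intro sum.cong prod.cong refl) auto
    also have "\<dots> = (\<Prod>i<n. \<Sum>t<?b i. if i = q then 1 else (cmod (g j i t))\<^sup>2)"
      by (rule sum_prod_mdigit)
    \<comment> \<open>Party \<open>q\<close> has radix 1, so its factor is a sum with the single
      term 1.\<close>
    also have "\<dots> = (\<Prod>i\<in>{..<n} - {q}. \<Sum>t<?b i. if i = q then 1 else (cmod (g j i t))\<^sup>2)"
      using q by (subst prod.remove[of _ q]) (simp_all add: col_radix_def)
    also have "\<dots> \<le> (\<Prod>i\<in>{..<n} - {q}. Kconst (d i) (M i) (x i))"
      by (rule prod_mono) (auto simp: col_radix_def K sum_nonneg)
    finally have "(\<Sum>c<l + ?C. (cmod (v j c))\<^sup>2) \<le> ?B"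
      unfolding sum_lessThan_add by (simp add: v_def)
    then have v_le: "L2_set (\<lambda>c. cmod (v j c)) {..<l + ?C} \<le> sqrt ?B"
      unfolding L2_set_def by (rule real_sqrt_le_mono)
    show "L2_set (\<lambda>r. cmod (u j r)) {..<l + N q * M q} * L2_set (\<lambda>c. cmod (v j c)) {..<l + ?C} \<le> sqrt ?A * sqrt ?B"
      \<comment> \<open>The side condition \<open>0 \<le> sqrt ?A\<close> holds because
        \<open>sqrt ?A\<close> dominates a norm by \<open>u_le\<close>.\<close>
      by (rule mult_mono[OF u_le v_le _ L2_set_nonneg]) (rule order_trans[OF L2_set_nonneg u_le])
  qed (use p0 in simp)
  also have "\<dots> = sqrt (?A * ?B)"
    unfolding sum_distrib_right[symmetric] p1 by (simp add: real_sqrt_mult)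
  finally show ?thesis .
qed

end
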